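(* Let $p>0$. Assume that there exist $q\in[1,\infty)$ and a numerical constant $c>0$ such that for any $\varphi\in\mathrm{BMOA}^{(2)}$ and any $f\in H^q(\ell^2)$, $$\Big\|\Big(\int_{\mathbb{T}}\big[(f*\varphi)(f*\varphi)^*\big]\,dm\Big)^{1/2}\Big\|_{S_p}\le c\,\|\varphi\|_{\mathrm{BMOA}^{(2)}}\cdot\|f\|_{H^q(\ell^2)} .$$ Then $p\ge4/3$.
   Context: $\mathbb{T}$ is the unit circle with normalized Haar measure $m$. $H^q(\ell^2)$ is the space of $f\in L^q(\mathbb{T};\ell^2)$ with $\widehat f(n)=0$ for $n<0$. $\ell^2$-vectors are regarded as columns, so $vv^*$ is a rank-one operator on $\ell^2$; $f*\varphi=\sum_{n\ge0}\widehat\varphi(n)\widehat f(n)e^{in\theta}$, so that $\int_{\mathbb{T}}(f*\varphi)(f*\varphi)^*dm=\sum_{n\ge0}|\widehat\varphi(n)|^2\widehat f(n)\widehat f(n)^*$. $S_p$ is the Schatten–von Neumann class on $\ell^2$, with $\|x\|_{S_p}=(\mathrm{Tr}|x|^p)^{1/p}$ (a quasi-norm if $p<1$). $\mathrm{BMOA}:=L^\infty(\mathbb{T})/\overline{H_0^\infty}$ with the quotient norm, where $\overline{H_0^\infty}=\{f\in L^\infty(\mathbb{T}):\widehat f(n)=0\ \forall n\ge0\}$; the class of $\psi\in L^\infty$ is identified with $\sum_{n\ge0}\widehat\psi(n)e^{in\theta}$. $\mathrm{BMOA}^{(2)}$ is the space of formal series $\varphi=\sum_{n\ge0}\widehat\varphi(n)e^{in\theta}$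 with $\|\varphi\|_{\mathrm{BMOA}^{(2)}}:=\big\|\sum_{n\ge0}|\widehat\varphi(n)|^2e^{in\theta}\big\|_{\mathrm{BMOA}}^{1/2}<\infty$. *)

theory Defs
  imports
    "HOL-Analysis.Analysis"
    "HOL-Probability.Probability_Measure"
    "HOL-Probability.Essential_Supremum"
    "HOL-Computational_Algebra.Formal_Power_Series"
    "HOL-Computational_Algebra.Polynomial"
begin

section \<open>The complex Hilbert space of square-summable sequences\<close>

lemma summable_cmod_power2_add:
  fixes x y :: "nat \<Rightarrow> complex"
  assumes "summable (\<lambda>n. (cmod (x n))\<^sup>2)" "summable (\<lambda>n. (cmod (y n))\<^sup>2)"
  shows "summable (\<lambda>n. (cmod (x n + y n))\<^sup>2)"
proof (rule summable_comparison_test')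
  show "summable (\<lambda>n. 2 * (cmod (x n))\<^sup>2 + 2 * (cmod (y n))\<^sup>2)"
    by (intro summable_add summable_mult assms)
  fix n :: nat
  have "(cmod (x n + y n))\<^sup>2 \<le> (cmod (x n) + cmod (y n))\<^sup>2"
    by (intro power_mono norm_triangle_ineq) auto
  also have "\<dots> \<le> 2 * (cmod (x n))\<^sup>2 + 2 * (cmod (y n))\<^sup>2"
    using sum_squares_bound[of "cmod (x n)" "cmod (y n)"] by (simp add: power2_sum)
  finally show "norm ((cmod (x n + y n))\<^sup>2) \<le> 2 * (cmod (x n))\<^sup>2 + 2 * (cmod (y n))\<^sup>2"
    by simp
qed

typedef ell2 = "{x :: nat \<Rightarrow> complex. summable (\<lambda>n. (cmod (x n))\<^sup>2)}"
  morphisms coord Abs_ell2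
  by (rule exI[of _ "\<lambda>_. 0"]) simp

setup_lifting type_definition_ell2

lemma summable_coord: "summable (\<lambda>n. (cmod (coord x n))\<^sup>2)"
  using coord[of x] by simp

instantiation ell2 :: real_vector
begin

lift_definition zero_ell2 :: ell2 is "\<lambda>_. 0" by simp

lift_definition plus_ell2 :: "ell2 \<Rightarrow> ell2 \<Rightarrow> ell2" is "\<lambda>x y n. x n + y n"
  by (rule summable_cmod_power2_add)

lift_definition uminus_ell2 :: "ell2 \<Rightarrow> ell2" is "\<lambda>x n. - x n" by simp

lift_definition minus_ell2 :: "ell2 \<Rightarrow> ell2 \<Rightarrow> ell2" is "\<lambda>x y n. x n - y n"
  using summable_cmod_power2_add[of _ "\<lambda>n. - _ n"] by simp

lift_definition scaleR_ell2 :: "real \<Rightarrow> ell2 \<Rightarrow> ell2" is "\<lambda>r x n. r *\<^sub>R x n"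
  by (simp add: power_mult_distrib summable_mult)

instance
  by standard (transfer; simp add: algebra_simps fun_eq_iff)+

end

lift_definition scaleC :: "complex \<Rightarrow> ell2 \<Rightarrow> ell2" is "\<lambda>c x n. c * x n"
  by (simp add: norm_mult power_mult_distrib summable_mult)

text \<open>The inner product is linear in its first argument.\<close>

definition cinner :: "ell2 \<Rightarrow> ell2 \<Rightarrow> complex"
  where "cinner x y = (\<Sum>n. coord x n * cnj (coord y n))"

lift_definition unit_vec :: "nat \<Rightarrow> ell2" is "\<lambda>k n. if n = k then 1 else 0"
proof -
  fix k :: nat
  have "(\<lambda>n. (cmod (if n = k then 1 else 0))\<^sup>2) = (\<lambda>n. if n = k then 1 else 0)" by auto
  then show "summable (\<lambda>n. (cmod (if n = k then 1 else 0))\<^sup>2)" by simp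
qed

lemma coord_add: "coord (x + y) n = coord x n + coord y n"
  by transfer simp
lemma coord_diff: "coord (x - y) n = coord x n - coord y n"
  by transfer simp
lemma coord_scaleR: "coord (r *\<^sub>R x) n = r *\<^sub>R coord x n"
  by transfer simp
lemma coord_scaleC: "coord (scaleC c x) n = c * coord x n"
  by transfer simp
lemma coord_zero: "coord 0 n = 0"
  by transfer simp
lemmas coord_simps = coord_add coord_diff coord_scaleR coord_scaleC coord_zero

lemma ell2_eqI: "(\<And>n. coord x n = coord y n) \<Longrightarrow> x = y"
  by transfer auto

lemma summable_cinner: "summable (\<lambda>n. coord x n * cnj (coord y n))"
proof (rule summable_comparison_test')
  show "summable (\<lambda>n. (cmod (coord x n))\<^sup>2 + (cmod (coord y n))\<^sup>2)"
    by (intro summable_add summable_coord)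
  fix n :: nat
  have "2 * (cmod (coord x n) * cmod (coord y n)) \<le> (cmod (coord x n))\<^sup>2 + (cmod (coord y n))\<^sup>2"
    using sum_squares_bound[of "cmod (coord x n)" "cmod (coord y n)"] by simp
  moreover have "0 \<le> cmod (coord x n) * cmod (coord y n)" by simp
  ultimately show "norm (coord x n * cnj (coord y n)) \<le> (cmod (coord x n))\<^sup>2 + (cmod (coord y n))\<^sup>2"
    unfolding norm_mult complex_mod_cnj by linarith
qed

lemma cinner_add_left: "cinner (x + y) z = cinner x z + cinner y z"
  unfolding cinner_def coord_simps distrib_right
  by (intro suminf_add[symmetric] summable_cinner)

lemma cinner_scaleC_left: "cinner (scaleC c x) y = c * cinner x y"
  unfolding cinner_def coord_simps mult.assoc
  by (intro suminf_mult summable_cinner)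

lemma scaleR_scaleC: "r *\<^sub>R x = scaleC (of_real r) x"
  by (intro ell2_eqI) (simp add: coord_simps scaleR_conv_of_real)

lemma cinner_scaleR_left: "cinner (r *\<^sub>R x) y = r *\<^sub>R cinner x y"
  by (simp add: scaleR_scaleC cinner_scaleC_left scaleR_conv_of_real)

lemma cinner_commute: "cinner x y = cnj (cinner y x)"
  unfolding cinner_def using bounded_linear.suminf[OF bounded_linear_cnj summable_cinner[of y x]]
  by (simp add: mult.commute)

lemma cinner_self: "cinner x x = of_real (\<Sum>n. (cmod (coord x n))\<^sup>2)"
  unfolding cinner_def suminf_of_real[OF summable_coord]
  by (intro suminf_cong) (rule complex_norm_square[symmetric])

instantiation ell2 :: real_inner
begin

definition inner_ell2 :: "ell2 \<Rightarrow> ell2 \<Rightarrow> real"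
  where "inner_ell2 x y = Re (cinner x y)"
definition norm_ell2 :: "ell2 \<Rightarrow> real"
  where "norm_ell2 x = sqrt (\<Sum>n. (cmod (coord x n))\<^sup>2)"
definition dist_ell2 :: "ell2 \<Rightarrow> ell2 \<Rightarrow> real"
  where "dist_ell2 x y = norm (x - y)"
definition sgn_ell2 :: "ell2 \<Rightarrow> ell2"
  where "sgn_ell2 x = inverse (norm x) *\<^sub>R x"
definition uniformity_ell2 :: "(ell2 \<times> ell2) filter"
  where "uniformity_ell2 = (INF e\<in>{0<..}. principal {(x, y). dist x y < e})"
definition open_ell2 :: "ell2 set \<Rightarrow> bool"
  where "open_ell2 U = (\<forall>x\<in>U. \<forall>\<^sub>F (x', y) in uniformity. x' = x \<longrightarrow> y \<in> U)"

instance
proof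
  fix x y z :: ell2 and r :: real
  show "dist x y = norm (x - y)" by (rule dist_ell2_def)
  show "sgn x = inverse (norm x) *\<^sub>R x" by (rule sgn_ell2_def)
  show "inner x y = inner y x"
    unfolding inner_ell2_def by (subst cinner_commute) simp
  show "inner (x + y) z = inner x z + inner y z"
    by (simp add: inner_ell2_def cinner_add_left)
  show "inner (r *\<^sub>R x) y = r * inner x y"
    by (simp add: inner_ell2_def cinner_scaleR_left)
  show "0 \<le> inner x x"
    by (simp add: inner_ell2_def cinner_self suminf_nonneg summable_coord)
  show "inner x x = 0 \<longleftrightarrow> x = 0"
  proof
    assume "inner x x = 0"
    then have "(\<Sum>n. (cmod (coord x n))\<^sup>2) = 0"
      by (simp add: inner_ell2_def cinner_self)
    then have "\<forall>n. (cmod (coord x n))\<^sup>2 = 0"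
      by (subst (asm) suminf_eq_zero_iff[OF summable_coord]) auto
    then show "x = 0" by (intro ell2_eqI) (simp add: coord_zero)
  qed (simp add: inner_ell2_def cinner_self coord_zero)
  show "norm x = sqrt (inner x x)"
    by (simp add: norm_ell2_def inner_ell2_def cinner_self)
qed (rule uniformity_ell2_def open_ell2_def)+

end

lemma norm_ell2_le_iff:
  assumes "0 \<le> e"
  shows "norm (x :: ell2) \<le> e \<longleftrightarrow> (\<forall>N. (\<Sum>n<N. (cmod (coord x n))\<^sup>2) \<le> e\<^sup>2)"
proof
  assume "norm x \<le> e"
  then have "(\<Sum>n. (cmod (coord x n))\<^sup>2) \<le> e\<^sup>2"
    unfolding norm_ell2_def using assms real_sqrt_le_iff[of _ "e\<^sup>2"] by simp
  then show "\<forall>N. (\<Sum>n<N. (cmod (coord x n))\<^sup>2) \<le> e\<^sup>2"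
    using sum_le_suminf[OF summable_coord, of _ x] by (meson finite_lessThan order_trans zero_le_power2)
next
  assume "\<forall>N. (\<Sum>n<N. (cmod (coord x n))\<^sup>2) \<le> e\<^sup>2"
  then have "(\<Sum>n. (cmod (coord x n))\<^sup>2) \<le> e\<^sup>2"
    by (intro suminf_le_const summable_coord) auto
  then show "norm x \<le> e"
    unfolding norm_ell2_def using assms by (simp add: real_le_lsqrt suminf_nonneg summable_coord)
qed

lemma cmod_coord_le: "cmod (coord x n) \<le> norm x"
proof -
  have "(\<Sum>k<Suc n. (cmod (coord x k))\<^sup>2) \<le> (norm x)\<^sup>2"
    using norm_ell2_le_iff[of "norm x" x] by (metis norm_ge_zero order_refl)
  moreover have "(cmod (coord x n))\<^sup>2 \<le> (\<Sum>k<Suc n. (cmod (coord x k))\<^sup>2)"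
    by (simp add: sum_nonneg)
  ultimately have "(cmod (coord x n))\<^sup>2 \<le> (norm x)\<^sup>2" by linarith
  then show ?thesis by (rule power2_le_imp_le) simp
qed

lemma norm_scaleC: "norm (scaleC c x) = cmod c * norm x"
  unfolding norm_ell2_def
  by (simp add: coord_simps norm_mult power_mult_distrib suminf_mult summable_coord real_sqrt_mult)

lemma cmod_cinner_le: "cmod (cinner x y) \<le> norm x * norm y"
proof -
  let ?c = "cinner x y"
  have "(cmod ?c)\<^sup>2 = inner (scaleC (cnj ?c) x) y"
    unfolding inner_ell2_def cinner_scaleC_left
    by (metis Re_complex_of_real complex_norm_square mult.commute)
  also have "\<dots> \<le> cmod ?c * (norm x * norm y)"
    using norm_cauchy_schwarz[of "scaleC (cnj ?c) x" y] by (simp add: norm_scaleC mult.assoc)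
  finally show ?thesis
    by (cases "?c = 0") (simp_all add: power2_eq_square)
qed

instance ell2 :: banach
proof
  fix X :: "nat \<Rightarrow> ell2" assume X: "Cauchy X"
  have "Cauchy (\<lambda>i. coord (X i) n)" for n
  proof (rule metric_CauchyI)
    fix e :: real assume "e > 0"
    then obtain M where M: "\<forall>i\<ge>M. \<forall>j\<ge>M. dist (X i) (X j) < e"
      using X unfolding Cauchy_def by blast
    have "dist (coord (X i) n) (coord (X j) n) \<le> dist (X i) (X j)" for i j
      using cmod_coord_le[of "X i - X j" n] by (simp add: dist_norm coord_simps)
    then show "\<exists>M. \<forall>i\<ge>M. \<forall>j\<ge>M. dist (coord (X i) n) (coord (X j) n) < e"
      using M le_less_trans by blast
  qed
  then have "\<forall>n. \<exists>l. (\<lambda>i. coord (X i) n) \<longlonglongrightarrow> l"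
    using Cauchy_convergent convergent_def by blast
  then obtain y where y: "\<And>n. (\<lambda>i. coord (X i) n) \<longlonglongrightarrow> y n" by metis
  have bound: "(\<Sum>n<N. (cmod (coord (X i) n - y n))\<^sup>2) \<le> e\<^sup>2"
    if M: "\<forall>i\<ge>M. \<forall>j\<ge>M. dist (X i) (X j) < e" and i: "i \<ge> M" for e M i N
  proof (rule LIMSEQ_le_const2)
    show "(\<lambda>j. \<Sum>n<N. (cmod (coord (X i) n - coord (X j) n))\<^sup>2)
        \<longlonglongrightarrow> (\<Sum>n<N. (cmod (coord (X i) n - y n))\<^sup>2)"
      by (intro tendsto_intros y)
    have "e > 0" using M i zero_le_dist[of "X i" "X i"] by (meson le_less_trans)
    have "(\<Sum>n<N. (cmod (coord (X i) n - coord (X j) n))\<^sup>2) \<le> e\<^sup>2" if "j \<ge> M" for j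
      using norm_ell2_le_iff[of e "X i - X j"] M i that \<open>e > 0\<close>
      by (auto simp: dist_norm coord_simps less_imp_le)
    then show "\<exists>M. \<forall>j\<ge>M. (\<Sum>n<N. (cmod (coord (X i) n - coord (X j) n))\<^sup>2) \<le> e\<^sup>2" by blast
  qed
  obtain M0 where M0: "\<forall>i\<ge>M0. \<forall>j\<ge>M0. dist (X i) (X j) < 1"
    using X unfolding Cauchy_def by (meson zero_less_one)
  have "summable (\<lambda>n. (cmod (coord (X M0) n - y n))\<^sup>2)"
    using bound[OF M0 order_refl] by (intro summableI_nonneg_bounded) auto
  then have "summable (\<lambda>n. (cmod (coord (X M0) n + - (coord (X M0) n - y n)))\<^sup>2)"
    by (intro summable_cmod_power2_add summable_coord) (simp only: norm_minus_cancel)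
  then have "summable (\<lambda>n. (cmod (y n))\<^sup>2)" by simp
  then obtain Y where Y: "coord Y = y"
    using Abs_ell2_inverse[of y] by auto
  have "X \<longlonglongrightarrow> Y"
  proof (rule metric_LIMSEQ_I)
    fix e :: real assume "e > 0"
    then obtain M where M: "\<forall>i\<ge>M. \<forall>j\<ge>M. dist (X i) (X j) < e / 2"
      using X unfolding Cauchy_def by (meson half_gt_zero)
    have "dist (X i) Y \<le> e / 2" if "i \<ge> M" for i
      using bound[OF M that] \<open>e > 0\<close> unfolding dist_norm
      by (subst norm_ell2_le_iff) (simp_all add: coord_simps Y)
    then show "\<exists>M. \<forall>i\<ge>M. dist (X i) Y < e"
      using \<open>e > 0\<close> by (intro exI[of _ M]) (force intro: le_less_trans)
  qed
  then show "convergent X" by (auto simp: convergent_def)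
qed

instance ell2 :: second_countable_topology
proof
  obtain D0 :: "complex set" where D0: "countable D0"
      "\<And>X. open X \<Longrightarrow> X \<noteq> {} \<Longrightarrow> \<exists>d\<in>D0. d \<in> X"
    by (rule countable_dense_setE) blast
  define v where "v l = Abs_ell2 (\<lambda>n. if n < length l then l ! n else 0)" for l :: "complex list"
  have coord_v: "coord (v l) = (\<lambda>n. if n < length l then l ! n else 0)" for l
    unfolding v_def
    by (subst Abs_ell2_inverse) (auto intro!: summable_finite[of "{..<length l}"] split: if_splits)
  define D where "D = v ` lists D0"
  have "countable D" unfolding D_def using D0(1) by simp
  have dense: "\<exists>d\<in>D. dist x d < e" if "e > 0" for x e
  proof -
    have "(\<lambda>N. \<Sum>n. (cmod (coord x (n + N)))\<^sup>2) \<longlonglongrightarrow> 0"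
      by (rule suminf_exist_split2[OF summable_coord])
    then obtain N where N: "(\<Sum>n. (cmod (coord x (n + N)))\<^sup>2) < (e / 2)\<^sup>2"
      using \<open>e > 0\<close> order_tendstoD(2)[of _ 0 sequentially "(e / 2)\<^sup>2"]
      by (auto simp: eventually_sequentially)
    define d where "d = e / (2 * sqrt (real N + 1))"
    have d: "d > 0" using \<open>e > 0\<close> by (simp add: d_def add_nonneg_pos)
    have "\<exists>q\<in>D0. cmod (coord x n - q) < d" for n
      using D0(2)[of "ball (coord x n) d"] d by (auto simp: dist_norm)
    then obtain q where q: "\<And>n. q n \<in> D0" "\<And>n. cmod (coord x n - q n) < d" by metis
    define z where "z = x - v (map q [0..<N])"
    have z: "coord z n = (if n < N then coord x n - q n else coord x n)" for n
      by (simp add: z_def coord_simps coord_v)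
    have "(\<Sum>n. (cmod (coord z n))\<^sup>2) = (\<Sum>n. (cmod (coord z (n + N)))\<^sup>2) + (\<Sum>n<N. (cmod (coord z n))\<^sup>2)"
      by (rule suminf_split_initial_segment[OF summable_coord])
    also have "(\<Sum>n. (cmod (coord z (n + N)))\<^sup>2) < (e / 2)\<^sup>2" using N by (simp add: z)
    also have "(\<Sum>n<N. (cmod (coord z n))\<^sup>2) \<le> (\<Sum>n<N. d\<^sup>2)"
      using q(2) by (intro sum_mono power_mono) (auto simp: z less_imp_le)
    also have "(\<Sum>n<N. d\<^sup>2) \<le> (e / 2)\<^sup>2"
    proof -
      have "d\<^sup>2 = (e / 2)\<^sup>2 / (real N + 1)"
        by (simp add: d_def power_divide power_mult_distrib)
      then have "(real N + 1) * d\<^sup>2 = (e / 2)\<^sup>2" by (simp only: times_divide_eq_right) simp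
      then show ?thesis by (simp add: distrib_right) (smt (verit) zero_le_power2)
    qed
    also have "(e / 2)\<^sup>2 + (e / 2)\<^sup>2 \<le> e\<^sup>2" by (simp add: power_divide)
    finally have "norm z < sqrt (e\<^sup>2)" unfolding norm_ell2_def by (intro real_sqrt_less_mono) simp
    then have "dist x (v (map q [0..<N])) < e" using \<open>e > 0\<close> by (simp add: z_def dist_norm)
    moreover have "v (map q [0..<N]) \<in> D" unfolding D_def using q(1) by (auto simp: in_lists_conv_set)
    ultimately show ?thesis by blast
  qed
  define B where "B = (\<lambda>(d, k). ball d (1 / real (Suc k))) ` (D \<times> (UNIV :: nat set))"
  have "topological_basis B"
  proof (rule topological_basisI)
    show "open b" if "b \<in> B" for b using that by (auto simp: B_def)
    fix U and x :: ell2 assume "open U" "x \<in> U"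
    then obtain e where e: "e > 0" "ball x e \<subseteq> U" using openE by blast
    obtain k where k: "1 / real (Suc k) < e / 2"
      using nat_approx_posE[of "e / 2"] e(1) by (metis half_gt_zero)
    obtain d where d: "d \<in> D" "dist x d < 1 / real (Suc k)"
      using dense[of "1 / real (Suc k)" x] by auto
    have "ball d (1 / real (Suc k)) \<subseteq> U"
    proof
      fix w assume "w \<in> ball d (1 / real (Suc k))"
      then have "dist x w < e"
        using dist_triangle[of x w d] d(2) k by simp
      then show "w \<in> U" using e(2) by auto
    qed
    moreover have "x \<in> ball d (1 / real (Suc k))" using d(2) by (simp add: dist_commute)
    moreover have "ball d (1 / real (Suc k)) \<in> B" using d(1) by (force simp: B_def)
    ultimately show "\<exists>b\<in>B. x \<in> b \<and> b \<subseteq> U" by blast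
  qed
  moreover have "countable B" unfolding B_def using \<open>countable D\<close> by auto
  ultimately show "\<exists>B :: ell2 set set. countable B \<and> open = generate_topology B"
    using topological_basis_imp_subbasis by blast
qed


section \<open>Schatten quasi-norms\<close>

text \<open>
  Operators are bounded real-linear maps; every operator occurring below is complex-linear.
\<close>

definition adj :: "(ell2 \<Rightarrow>\<^sub>L ell2) \<Rightarrow> (ell2 \<Rightarrow>\<^sub>L ell2)"
  where "adj T = (THE S. \<forall>x y. cinner (T x) y = cinner x (blinfun_apply S y))"

definition op_poly :: "real poly \<Rightarrow> (ell2 \<Rightarrow>\<^sub>L ell2) \<Rightarrow> (ell2 \<Rightarrow>\<^sub>L ell2)"
  where "op_poly r A = (\<Sum>i\<le>degree r. coeff r i *\<^sub>R ((\<lambda>X. A o\<^sub>L X) ^^ i) id_blinfun)"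

text \<open>
  The power \<open>A\<^sup>s\<close> (\<open>s > 0\<close>) of a positive operator by continuous functional calculus: the
  spectrum of \<open>A\<close> lies in \<open>[0, \<parallel>A\<parallel>]\<close>, and \<open>A\<^sup>s\<close> is the norm limit of \<open>r(A)\<close> for polynomials
  \<open>r\<close> tending to \<open>t\<^sup>s\<close> uniformly on that interval. Only meaningful for positive \<open>A\<close>.
\<close>

definition op_powr :: "(ell2 \<Rightarrow>\<^sub>L ell2) \<Rightarrow> real \<Rightarrow> (ell2 \<Rightarrow>\<^sub>L ell2)"
  where "op_powr A s = (THE B. \<forall>\<epsilon>>0. \<exists>r.
           (\<forall>t\<in>{0..norm A}. \<bar>poly r t - t powr s\<bar> \<le> \<epsilon>) \<and> norm (op_poly r A - B) \<le> \<epsilon>)"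

definition op_abs :: "(ell2 \<Rightarrow>\<^sub>L ell2) \<Rightarrow> (ell2 \<Rightarrow>\<^sub>L ell2)"
  where "op_abs T = op_powr (adj T o\<^sub>L T) (1/2)"

text \<open>The trace of a positive operator, possibly infinite.\<close>

definition op_trace :: "(ell2 \<Rightarrow>\<^sub>L ell2) \<Rightarrow> ennreal"
  where "op_trace A = (\<Sum>n. ennreal (Re (cinner (A (unit_vec n)) (unit_vec n))))"

text \<open>The value is \<open>\<infinity>\<close> for operators outside the class \<open>S\<^sub>p\<close>.\<close>

definition schatten_norm :: "real \<Rightarrow> (ell2 \<Rightarrow>\<^sub>L ell2) \<Rightarrow> ennreal"
  where "schatten_norm p T =
    (let t = op_trace (op_powr (op_abs T) p)
     in if t = \<infinity> then \<infinity> else ennreal (enn2real t powr (1/p)))"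

definition rank_one :: "ell2 \<Rightarrow> (ell2 \<Rightarrow>\<^sub>L ell2)"  \<comment> \<open>\<open>v v\<^sup>*\<close>\<close>
  where "rank_one v = Blinfun (\<lambda>h. scaleC (cinner h v) v)"

lemma rank_one_apply: "rank_one v h = scaleC (cinner h v) v"
proof -
  have "bounded_linear (\<lambda>h. scaleC (cinner h v) v)"
  proof (rule bounded_linear_intro)
    show "norm (scaleC (cinner h v) v) \<le> norm h * (norm v * norm v)" for h
      using mult_right_mono[OF cmod_cinner_le[of h v], of "norm v"]
      by (simp add: norm_scaleC mult.assoc)
  qed (auto intro!: ell2_eqI
      simp: coord_simps cinner_add_left cinner_scaleR_left distrib_right scaleR_conv_of_real)
  then show ?thesis unfolding rank_one_def by (simp add: bounded_linear_Blinfun_apply)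
qed

text \<open>
  The integral of an operator-valued function in the strong sense. (The operator space is not
  separable, so the Bochner integral of the library is not available on it.)
\<close>

definition op_integral :: "'a measure \<Rightarrow> ('a \<Rightarrow> (ell2 \<Rightarrow>\<^sub>L ell2)) \<Rightarrow> (ell2 \<Rightarrow>\<^sub>L ell2)"
  where "op_integral M F = Blinfun (\<lambda>h. LINT z|M. F z h)"


section \<open>Function spaces on the circle\<close>

definition circle_haar :: "complex measure"
  where "circle_haar =
    distr (uniform_measure lborel {0..<2*pi}) (restrict_space borel (sphere 0 1)) cis"

definition Lq :: "real \<Rightarrow> (complex \<Rightarrow> ell2) set"
  where "Lq q = {f \<in> borel_measurable circle_haar. integrable circle_haar (\<lambda>z. norm (f z) powr q)}"

definition Lq_norm :: "real \<Rightarrow> (complex \<Rightarrow> ell2) \<Rightarrow> real"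
  where "Lq_norm q f = (LINT z|circle_haar. norm (f z) powr q) powr (1/q)"

definition vfourier :: "(complex \<Rightarrow> ell2) \<Rightarrow> int \<Rightarrow> ell2"
  where "vfourier f n = (LINT z|circle_haar. scaleC (z powi (-n)) (f z))"

definition Hardy :: "real \<Rightarrow> (complex \<Rightarrow> ell2) set"
  where "Hardy q = {f \<in> Lq q. \<forall>n<0. vfourier f n = 0}"

definition Linf_norm :: "(complex \<Rightarrow> complex) \<Rightarrow> ennreal"
  where "Linf_norm \<psi> = esssup circle_haar (\<lambda>z. ennreal (cmod (\<psi> z)))"

definition Linf :: "(complex \<Rightarrow> complex) set"
  where "Linf = {\<psi> \<in> borel_measurable circle_haar. Linf_norm \<psi> < \<infinity>}"

definition fourier :: "(complex \<Rightarrow> complex) \<Rightarrow> int \<Rightarrow> complex"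
  where "fourier \<psi> n = (LINT z|circle_haar. z powi (-n) * \<psi> z)"

definition conj_Hinf0 :: "(complex \<Rightarrow> complex) set"
  where "conj_Hinf0 = {h \<in> Linf. \<forall>n\<ge>0. fourier h n = 0}"

text \<open>
  The set of bounded functions in the class identified with a formal series \<open>b\<close>. By the lemma
  \<open>BMOA_class_eq_coset\<close> it is empty or a coset of \<^const>\<open>conj_Hinf0\<close>, so that
  the quotient norm is the infimum over it (and \<open>\<infinity>\<close> if \<open>b\<close> is not in BMOA).
\<close>

definition BMOA_class :: "complex fps \<Rightarrow> (complex \<Rightarrow> complex) set"
  where "BMOA_class b = {\<psi> \<in> Linf. \<forall>n. fourier \<psi> (int n) = fps_nth b n}"

definition BMOA_norm :: "complex fps \<Rightarrow> ennreal"
  where "BMOA_norm b = (INF \<psi>\<in>BMOA_class b. Linf_norm \<psi>)"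

definition BMOA2_series :: "complex fps \<Rightarrow> complex fps"
  where "BMOA2_series \<phi> = Abs_fps (\<lambda>n. of_real ((cmod (fps_nth \<phi> n))\<^sup>2))"

definition BMOA2 :: "complex fps set"
  where "BMOA2 = {\<phi>. BMOA_norm (BMOA2_series \<phi>) < \<infinity>}"

definition BMOA2_norm :: "complex fps \<Rightarrow> real"
  where "BMOA2_norm \<phi> = sqrt (enn2real (BMOA_norm (BMOA2_series \<phi>)))"

text \<open>
  \<open>is_conv f \<phi> g\<close>: the function \<open>g\<close> represents \<open>f * \<phi>\<close>. For \<open>\<phi> \<in> BMOA2\<close> and \<open>f \<in> Hardy q\<close> with
  \<open>q \<ge> 1\<close> such a \<open>g\<close> exists and is unique almost everywhere: if \<open>\<psi> \<in> BMOA_class (BMOA2_series \<phi>)\<close>,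
  pairing \<open>\<psi>\<close> with the \<open>H\<^sup>1\<close> function \<open>w \<mapsto> \<integral> \<langle>f(wz), f(z)\<rangle> dm(z)\<close>, whose coefficients are
  \<open>\<parallel>vfourier f n\<parallel>\<^sup>2\<close>, gives \<open>\<Sum>n. \<bar>\<phi>\<^sub>n\<bar>\<^sup>2 \<parallel>vfourier f n\<parallel>\<^sup>2 \<le> \<parallel>\<psi>\<parallel>\<^sub>\<infinity> \<parallel>f\<parallel>\<^sub>1\<^sup>2\<close>.
\<close>

definition is_conv :: "(complex \<Rightarrow> ell2) \<Rightarrow> complex fps \<Rightarrow> (complex \<Rightarrow> ell2) \<Rightarrow> bool"
  where "is_conv f \<phi> g \<longleftrightarrow>
    g \<in> Hardy 2 \<and> (\<forall>n. vfourier g (int n) = scaleC (fps_nth \<phi> n) (vfourier f (int n)))"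


lemma cis_measurable_circle:
  "cis \<in> measurable (uniform_measure lborel {0..<2*pi}) (restrict_space borel (sphere 0 1))"
proof (rule measurable_restrict_space2)
  show "cis \<in> borel_measurable (uniform_measure lborel {0..<2*pi})"
    using borel_measurable_continuous_onI[of cis] continuous_on_cis[OF continuous_on_id, of UNIV] by simp
qed auto

lemma space_circle_haar: "space circle_haar = sphere 0 1"
  by (simp add: circle_haar_def space_restrict_space)

lemma prob_space_circle_haar: "prob_space circle_haar"
  unfolding circle_haar_def
  by (intro prob_space.prob_space_distr[OF _ cis_measurable_circle] prob_space_uniform_measure) auto

lemma Linf_D:
  assumes "\<psi> \<in> Linf"
  obtains C where "C \<ge> 0" "AE z in circle_haar. cmod (\<psi> z) \<le> C"
proof -
  have "AE z in circle_haar. ennreal (cmod (\<psi> z)) \<le> Linf_norm \<psi>"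
    unfolding Linf_norm_def by (rule esssup_AE)
  moreover have "Linf_norm \<psi> = ennreal (enn2real (Linf_norm \<psi>))"
    using assms by (simp add: Linf_def less_top)
  ultimately have "AE z in circle_haar. cmod (\<psi> z) \<le> enn2real (Linf_norm \<psi>)"
    by (metis (mono_tags, lifting) AE_mp AE_I2 enn2real_nonneg ennreal_le_iff)
  then show thesis using that enn2real_nonneg by blast
qed

lemma Linf_I:
  assumes "\<psi> \<in> borel_measurable circle_haar" "AE z in circle_haar. cmod (\<psi> z) \<le> C"
  shows "\<psi> \<in> Linf"
proof -
  have "Linf_norm \<psi> \<le> ennreal C"
    unfolding Linf_norm_def using assms
    by (intro esssup_I) (auto elim!: AE_mp intro!: ennreal_leI)
  then show ?thesis using assms by (auto simp: Linf_def intro: le_less_trans)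
qed

lemma powi_measurable: "(\<lambda>z. z powi n) \<in> borel_measurable circle_haar"
proof -
  have "continuous_on (sphere 0 1) (\<lambda>z :: complex. z powi n)"
    by (intro continuous_intros) auto
  then have "(\<lambda>z :: complex. z powi n) \<in> borel_measurable (restrict_space borel (sphere 0 1))"
    by (rule borel_measurable_continuous_on_restrict)
  then show ?thesis by (simp add: circle_haar_def)
qed

lemma integrable_fourier:
  assumes "\<psi> \<in> Linf"
  shows "integrable circle_haar (\<lambda>z. z powi n * \<psi> z)"
proof -
  interpret prob_space circle_haar by (rule prob_space_circle_haar)
  obtain C where C: "C \<ge> 0" "AE z in circle_haar. cmod (\<psi> z) \<le> C" using Linf_D[OF assms] .
  have "AE z in circle_haar. cmod (z powi n * \<psi> z) \<le> C"
    using C(2) AE_space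
    by eventually_elim (auto simp: space_circle_haar norm_mult norm_power_int)
  then show ?thesis
    using assms powi_measurable by (intro integrable_const_bound) (auto simp: Linf_def)
qed

lemma BMOA_class_eq_coset:
  assumes "\<psi> \<in> BMOA_class b"
  shows "BMOA_class b = {(\<lambda>z. \<psi> z + h z) | h. h \<in> conj_Hinf0}"
proof -
  have \<psi>: "\<psi> \<in> Linf" "\<And>n. fourier \<psi> (int n) = fps_nth b n"
    using assms by (auto simp: BMOA_class_def)
  obtain C where C: "AE z in circle_haar. cmod (\<psi> z) \<le> C" using Linf_D[OF \<psi>(1)] .
  have plus: "(\<lambda>z. \<psi> z + h z) \<in> BMOA_class b" if h: "h \<in> conj_Hinf0" for h
  proof -
    have hL: "h \<in> Linf" and h0: "\<And>n. fourier h (int n) = 0"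
      using h by (auto simp: conj_Hinf0_def)
    obtain C' where C': "AE z in circle_haar. cmod (h z) \<le> C'" using Linf_D[OF hL] .
    have "AE z in circle_haar. cmod (\<psi> z + h z) \<le> C + C'"
      using C C' by eventually_elim (rule norm_triangle_mono)
    then have "(\<lambda>z. \<psi> z + h z) \<in> Linf"
      using \<psi>(1) hL by (intro Linf_I) (auto simp: Linf_def)
    moreover have "fourier (\<lambda>z. \<psi> z + h z) n = fourier \<psi> n + fourier h n" for n
      unfolding fourier_def distrib_left
      by (intro Bochner_Integration.integral_add integrable_fourier \<psi> hL)
    ultimately show ?thesis by (simp add: BMOA_class_def \<psi>(2) h0)
  qed
  moreover have "\<exists>h\<in>conj_Hinf0. \<psi>' = (\<lambda>z. \<psi> z + h z)" if \<psi>': "\<psi>' \<in> BMOA_class b" for \<psi>'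
  proof (rule bexI)
    have \<psi>'L: "\<psi>' \<in> Linf" and \<psi>'b: "\<And>n. fourier \<psi>' (int n) = fps_nth b n"
      using \<psi>' by (auto simp: BMOA_class_def)
    obtain C' where C': "AE z in circle_haar. cmod (\<psi>' z) \<le> C'" using Linf_D[OF \<psi>'L] .
    have "AE z in circle_haar. cmod (\<psi>' z - \<psi> z) \<le> C' + C"
      using C C' by eventually_elim (metis add_mono norm_triangle_ineq4 order_trans)
    then have "(\<lambda>z. \<psi>' z - \<psi> z) \<in> Linf"
      using \<psi>(1) \<psi>'L by (intro Linf_I) (auto simp: Linf_def)
    moreover have "fourier (\<lambda>z. \<psi>' z - \<psi> z) n = fourier \<psi>' n - fourier \<psi> n" for n
      unfolding fourier_def right_diff_distrib
      by (intro Bochner_Integration.integral_diff integrable_fourier \<psi> \<psi>'L)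
    then have "\<forall>n\<ge>0. fourier (\<lambda>z. \<psi>' z - \<psi> z) n = 0"
      by (metis \<psi>'b \<psi>(2) diff_self nonneg_int_cases)
    ultimately show "(\<lambda>z. \<psi>' z - \<psi> z) \<in> conj_Hinf0" by (simp add: conj_Hinf0_def)
  qed auto
  ultimately show ?thesis by blast
qed

end

theory Submission
  imports Defs "HOL-Complex_Analysis.Complex_Analysis" "HOL-Real_Asymp.Real_Asymp"
begin

text \<open>
  The inequality is tested on lacunary polynomials with orthogonal coefficients. Let
  \<open>f(z) = \<Sum>k<N. z\<^bsup>3^k\<^esup> e\<^sub>k\<close>, so that \<open>\<parallel>f(z)\<parallel> = \<surd>N\<close> on the whole circle and hence \<open>\<parallel>f\<parallel> = \<surd>N\<close> in \<open>H\<^sup>q\<close>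
  for every \<open>q\<close>. The operator on the left-hand side is then diagonal with entries \<open>\<bar>\<phi>(3^k)\<bar>\<close>. If
  \<open>\<phi>\<close> has norm at most 1 in BMOA2 and \<open>\<bar>\<phi>(3^k)\<bar>\<close> is at least of order \<open>N\<^bsup>-1/4\<^esup>\<close> for all \<open>k < N\<close>, the
  inequality gives \<open>N\<^bsup>1/p - 1/4\<^esup> \<le> C N\<^bsup>1/2\<^esup>\<close> for all \<open>N\<close>, that is \<open>1/p \<le> 3/4\<close>.

  Such a \<open>\<phi>\<close> exists by the classical fact that a lacunary series has BMOA norm comparable with the
  \<open>\<ell>\<^sup>2\<close> norm of its coefficients: \<open>\<Sum>k<N. z\<^bsup>3^k\<^esup>\<close> has norm of order \<open>\<surd>N\<close>. What is needed is an
  explicit function \<open>\<psi>\<close> bounded by 1, with nonnegative coefficients at all nonnegative frequencies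
  that are of order \<open>1/\<surd>N\<close> at the frequencies \<open>3^k\<close> (\<open>bounded_lacunary_symbol\<close>). It is built by a
  Schur-type recursion: from \<open>\<psi>\<^sub>k\<close>, bounded by 1 and with no frequency above \<open>d < n/2\<close>, pass to
  \<open>\<psi>\<^sub>k\<^sub>+\<^sub>1 = (\<psi>\<^sub>k + b) / (1 + cnj b \<psi>\<^sub>k)\<close> where \<open>b = a z\<^sup>n\<close> and \<open>n = 3^k\<close>. The bound 1 persists because
  Moebius transformations preserve the disc, and the terms of order two and higher in \<open>\<psi>\<^sub>k\<close> have
  only negative frequencies, so the nonnegative frequencies of \<open>\<psi>\<^sub>k\<^sub>+\<^sub>1\<close> are those of
  \<open>b + (1 - a\<^sup>2) \<psi>\<^sub>k\<close> (\<open>moebius_step\<close>). To reduce frequency bounds to holomorphy, \<open>\<psi>\<^sub>k\<close> is written on the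
  circle as \<open>z\<^sup>d cnj(H z)\<close> with \<open>H\<close> holomorphic on the closed disc.

  The remaining work identifies roots, absolute values and Schatten norms of diagonal operators.
\<close>

section \<open>Integration over the circle\<close>

lemma circle_haar_measurable_continuous:
  fixes f :: "complex \<Rightarrow> 'a :: topological_space"
  assumes "continuous_on (sphere 0 1) f"
  shows "f \<in> borel_measurable circle_haar"
  using borel_measurable_continuous_on_restrict[OF assms] by (simp add: circle_haar_def)

lemma circle_haar_integrable_continuous:
  fixes f :: "complex \<Rightarrow> 'a :: {banach, second_countable_topology}"
  assumes "continuous_on (sphere 0 1) f"
  shows "integrable circle_haar f"
proof -
  interpret prob_space circle_haar by (rule prob_space_circle_haar)
  have "bounded (f ` sphere 0 1)"
    using assms by (intro compact_imp_bounded compact_continuous_image) auto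
  then obtain B where B: "\<forall>z\<in>sphere 0 1. norm (f z) \<le> B" unfolding bounded_iff by blast
  have "f \<in> borel_measurable circle_haar"
    by (rule circle_haar_measurable_continuous[OF assms])
  then show ?thesis
    using B by (intro integrable_const_bound[of _ B]) (auto simp: space_circle_haar intro!: AE_I2)
qed

lemma circle_haar_integral:
  fixes f :: "complex \<Rightarrow> complex"
  assumes "continuous_on (sphere 0 1) f"
  shows "(LINT z|circle_haar. f z) = integral {0..2*pi} (\<lambda>t. f (cis t)) / (2 * pi)"
proof -
  have fm: "f \<in> borel_measurable (restrict_space borel (sphere 0 1))"
    by (rule borel_measurable_continuous_on_restrict[OF assms])
  have cont: "continuous_on UNIV (\<lambda>t. f (cis t))"
    by (intro continuous_on_compose2[OF assms] continuous_intros) auto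
  then have m: "(\<lambda>t. f (cis t)) \<in> borel_measurable lborel"
    using borel_measurable_continuous_onI by simp
  have "(LINT z|circle_haar. f z) = (LINT t|uniform_measure lborel {0..<2*pi}. f (cis t))"
    unfolding circle_haar_def by (rule integral_distr[OF cis_measurable_circle fm])
  also have "\<dots> = (LINT t|density lborel (\<lambda>t. ennreal (indicator {0..<2*pi} t / (2 * pi))). f (cis t))"
    by (simp add: uniform_measure_def divide_ennreal[symmetric] ennreal_indicator)
  also have "\<dots> = (LINT t|lborel. (indicator {0..<2*pi} t / (2 * pi)) *\<^sub>R f (cis t))"
    using m by (intro integral_density) auto
  also have "\<dots> = (LINT t|lborel. (1 / (2 * pi)) *\<^sub>R (indicator {0..2*pi} t *\<^sub>R f (cis t)))"
  proof (rule integral_cong_AE)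
    have "AE t in lborel. t \<noteq> 2 * pi" by (rule AE_lborel_singleton)
    then show "AE t in lborel. (indicator {0..<2*pi} t / (2 * pi)) *\<^sub>R f (cis t) =
        (1 / (2 * pi)) *\<^sub>R (indicator {0..2*pi} t *\<^sub>R f (cis t))"
      by eventually_elim (auto simp: indicator_def)
  qed (use m in measurable)
  also have "\<dots> = (1 / (2 * pi)) *\<^sub>R (LINT t:{0..2*pi}|lborel. f (cis t))"
    unfolding set_lebesgue_integral_def by (rule integral_scaleR_right)
  also have "(LINT t:{0..2*pi}|lborel. f (cis t)) = integral {0..2*pi} (\<lambda>t. f (cis t))"
    using borel_integrable_atLeastAtMost'[OF continuous_on_subset[OF cont]]
    by (intro set_borel_integral_eq_integral) auto
  finally show ?thesis by (simp add: scaleR_conv_of_real)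
qed

text \<open>
  Cauchy's integral formula at the centre. All Fourier coefficients needed below are computed from
  this mean value property.
\<close>

lemma circle_haar_mean_value:
  assumes "G holomorphic_on cball 0 1"
  shows "(LINT z|circle_haar. G z) = G 0"
proof -
  have "((\<lambda>u. G u / (u - 0)) has_contour_integral (2 * of_real pi * \<i> * G 0)) (circlepath 0 1)"
    by (rule Cauchy_integral_circlepath_simple[OF assms]) simp
  then have "((\<lambda>t. G (cis t) / cis t * \<i> * cis t) has_integral (2 * of_real pi * \<i> * G 0)) {0..2*pi}"
    unfolding circlepath_def by (subst (asm) has_contour_integral_part_circlepath_iff) simp_all
  then have "((\<lambda>t. - \<i> * (\<i> * G (cis t))) has_integral (- \<i> * (2 * of_real pi * \<i> * G 0))) {0..2*pi}"
    by (intro has_integral_mult_right) (simp add: mult_ac)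
  then have "((\<lambda>t. G (cis t)) has_integral (2 * of_real pi * G 0)) {0..2*pi}"
    by (simp add: mult.assoc[symmetric]) (simp add: mult_ac)
  then have "integral {0..2*pi} (\<lambda>t. G (cis t)) = 2 * of_real pi * G 0"
    by (rule integral_unique)
  moreover have "continuous_on (sphere 0 1) G"
    by (rule continuous_on_subset[OF holomorphic_on_imp_continuous_on[OF assms]]) auto
  ultimately show ?thesis by (simp add: circle_haar_integral)
qed

lemma inverse_eq_cnj: "cmod z = 1 \<Longrightarrow> inverse z = cnj z"
  by (rule inverse_unique) (simp add: complex_norm_square[symmetric])

lemma circle_haar_integral_powi:
  "(LINT z|circle_haar. z powi n) = (if n = 0 then 1 else 0)"
proof (cases "n \<ge> 0")
  case True
  then obtain m where n: "n = int m" using nonneg_int_cases by blast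
  have "(LINT z|circle_haar. z ^ m) = 0 ^ m"
    by (rule circle_haar_mean_value) (intro holomorphic_intros)
  then show ?thesis by (simp add: n power_0_left)
next
  case False
  then obtain m where n: "n = - int m" "m > 0" by (metis neg_int_cases not_le_imp_less)
  have "(LINT z|circle_haar. z powi n) = (LINT z|circle_haar. cnj (z ^ m))"
    by (rule Bochner_Integration.integral_cong)
      (simp_all add: n space_circle_haar power_int_minus inverse_eq_cnj norm_power del: complex_cnj_power)
  also have "\<dots> = cnj (LINT z|circle_haar. z ^ m)" by (rule Bochner_Integration.integral_cnj)
  also have "(LINT z|circle_haar. z ^ m) = 0 ^ m"
    by (rule circle_haar_mean_value) (intro holomorphic_intros)
  finally show ?thesis using n by simp
qed

section \<open>A bounded function with large lacunary coefficients\<close>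

lemma cnj_holomorphic_fourier_zero:
  assumes "K holomorphic_on cball 0 1" "m > 0"
  shows "(LINT z|circle_haar. cnj (z ^ m * K z)) = 0"
proof -
  have "(LINT z|circle_haar. cnj (z ^ m * K z)) = cnj (LINT z|circle_haar. z ^ m * K z)"
    by (rule Bochner_Integration.integral_cnj)
  also have "(LINT z|circle_haar. z ^ m * K z) = 0 ^ m * K 0"
    by (rule circle_haar_mean_value) (intro holomorphic_intros assms)
  finally show ?thesis using assms(2) by simp
qed

lemma cmod_moebius_le_1:
  assumes "0 \<le> a" "a < 1" "cmod w \<le> 1"
  shows "1 + of_real a * w \<noteq> 0" "cmod ((of_real a + w) / (1 + of_real a * w)) \<le> 1"
proof -
  have "cmod (of_real a * w) < 1"
    using assms mult_left_mono[OF assms(3,1)] by (simp add: norm_mult)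
  then show nz: "1 + of_real a * w \<noteq> 0"
    by (metis add_eq_0_iff norm_minus_cancel norm_one order_less_irrefl)
  have "(cmod (1 + of_real a * w))\<^sup>2 - (cmod (of_real a + w))\<^sup>2 = (1 - a\<^sup>2) * (1 - (cmod w)\<^sup>2)"
    by (simp only: cmod_power2) (simp add: power2_eq_square algebra_simps)
  also have "\<dots> \<ge> 0" using assms by (intro mult_nonneg_nonneg) (simp_all add: power_le_one)
  finally have "(cmod (of_real a + w))\<^sup>2 \<le> (cmod (1 + of_real a * w))\<^sup>2" by linarith
  then have "cmod (of_real a + w) \<le> cmod (1 + of_real a * w)"
    by (rule power2_le_imp_le) simp
  then show "cmod ((of_real a + w) / (1 + of_real a * w)) \<le> 1"
    using nz by (simp add: norm_divide divide_le_eq)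
qed

text \<open>
  The step of the construction. For \<open>\<psi>(z) = z\<^sup>d cnj(H z)\<close> on the circle and \<open>b(z) = a z\<^sup>n\<close>, the function
  \<open>z\<^sup>n cnj(H' z)\<close> below is the Moebius transform \<open>(\<psi> + b) / (1 + cnj b \<psi>)\<close>, which maps the unit disc to
  itself and hence keeps the bound 1. It equals
  \<open>b + (1 - a\<^sup>2) \<psi> - (1 - a\<^sup>2) cnj b \<psi>\<^sup>2 / (1 + cnj b \<psi>)\<close>. Since \<open>\<psi>\<close> has no frequency above \<open>d\<close>, the last
  term has none above \<open>2 d - n < 0\<close>, so that on the nonnegative frequencies the nonlinear
  transformation acts as the affine map \<open>\<psi> \<mapsto> b + (1 - a\<^sup>2) \<psi>\<close>.
\<close>

lemma moebius_step:
  fixes a :: real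
  assumes H: "H holomorphic_on cball 0 1" "\<And>z. cmod z \<le> 1 \<Longrightarrow> cmod (H z) \<le> 1"
    and a: "0 \<le> a" "a < 1" and n: "2 * d < n"
  obtains H' where "H' holomorphic_on cball 0 1" "\<And>z. cmod z \<le> 1 \<Longrightarrow> cmod (H' z) \<le> 1"
    "\<And>j. fourier (\<lambda>z. z ^ n * cnj (H' z)) (int j) =
       (if j = n then of_real a else 0) + of_real (1 - a\<^sup>2) * fourier (\<lambda>z. z ^ d * cnj (H z)) (int j)"
proof -
  define s where "s = n - d"
  \<comment> \<open>On the circle \<open>z\<^sup>n cnj (W z) = z\<^sup>d cnj (H z)\<close>, that is \<open>cnj W = cnj b \<psi> / a\<close> if \<open>a > 0\<close>.\<close>
  define W where "W z = z ^ s * H z" for z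
  define H' where "H' z = (of_real a + W z) / (1 + of_real a * W z)" for z
  have W1: "cmod (W z) \<le> 1" if "cmod z \<le> 1" for z
    using that H(2)[OF that] by (simp add: W_def norm_mult norm_power mult_le_one power_le_one)
  note mo = cmod_moebius_le_1[OF a W1]
  have Wh: "W holomorphic_on cball 0 1" unfolding W_def by (intro holomorphic_intros H)
  have H'h: "H' holomorphic_on cball 0 1"
    unfolding H'_def by (intro holomorphic_intros Wh) (use mo(1) in auto)
  \<comment> \<open>\<open>- a z\<^bsup>2s\<^esup> K(z)\<close> is the remainder of \<open>H'\<close> after the terms of order at most one in \<open>W\<close>; \<open>2 s > n\<close>.\<close>
  define K where "K z = (H z)\<^sup>2 * (1 - of_real a * H' z)" for z
  have Kh: "K holomorphic_on cball 0 1" unfolding K_def by (intro holomorphic_intros H H'h)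
  have expand: "H' z = of_real a + of_real (1 - a\<^sup>2) * W z - of_real a * (z ^ (2 * s) * K z)"
    if "cmod z \<le> 1" for z
  proof -
    have eq: "H' z * (1 + of_real a * W z) = of_real a + W z" using mo(1)[OF that] by (simp add: H'_def)
    have "z ^ (2 * s) * K z = (W z)\<^sup>2 * (1 - of_real a * H' z)"
      by (simp add: K_def W_def power_mult_distrib power_mult mult.commute)
    also have "\<dots> = W z * (W z - of_real a * (H' z * W z))" by (simp add: power2_eq_square algebra_simps)
    also have "W z - of_real a * (H' z * W z) = H' z - of_real a"
      using eq by algebra
    finally have K: "z ^ (2 * s) * K z = W z * (H' z - of_real a)" .
    have "H' z = of_real a + W z - of_real a * (W z * H' z)"
      using eq by algebra
    also have "\<dots> = of_real a + of_real (1 - a\<^sup>2) * W z - of_real a * (W z * (H' z - of_real a))"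
      by (simp add: algebra_simps power2_eq_square)
    finally show ?thesis unfolding K .
  qed
  have shift: "z ^ n * cnj (H' z) = of_real a * z ^ n + of_real (1 - a\<^sup>2) * (z ^ d * cnj (H z))
      - of_real a * cnj (z ^ (2 * s - n) * K z)" if "cmod z = 1" for z
  proof -
    have zz: "z ^ m * cnj (z ^ m) = 1" for m
      using that by (simp add: complex_norm_square[symmetric] norm_power del: complex_cnj_power)
    have n1: "z ^ n = z ^ d * z ^ s" using n by (simp add: s_def flip: power_add)
    have n2: "z ^ (2 * s) = z ^ n * z ^ (2 * s - n)" using n by (simp add: s_def flip: power_add)
    have "z ^ n * cnj (W z) = z ^ d * (z ^ s * cnj (z ^ s)) * cnj (H z)"
      by (simp add: W_def n1)
    then have 1: "z ^ n * cnj (W z) = z ^ d * cnj (H z)" by (simp only: zz) simp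
    have "z ^ n * cnj (z ^ (2 * s) * K z) = (z ^ n * cnj (z ^ n)) * cnj (z ^ (2 * s - n) * K z)"
      unfolding n2 by simp
    then have 2: "z ^ n * cnj (z ^ (2 * s) * K z) = cnj (z ^ (2 * s - n) * K z)" by (simp only: zz) simp
    have "z ^ n * cnj (H' z) = of_real a * z ^ n + of_real (1 - a\<^sup>2) * (z ^ n * cnj (W z))
        - of_real a * (z ^ n * cnj (z ^ (2 * s) * K z))"
      using that by (subst expand) (simp_all add: algebra_simps)
    then show ?thesis unfolding 1 2 .
  qed
  have F: "fourier (\<lambda>z. z ^ n * cnj (H' z)) (int j) =
       (if j = n then of_real a else 0) + of_real (1 - a\<^sup>2) * fourier (\<lambda>z. z ^ d * cnj (H z)) (int j)" for j
  proof -
    have "fourier (\<lambda>z. z ^ n * cnj (H' z)) (int j) = (LINT z|circle_haar.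
        of_real a * z powi (int n - int j) + of_real (1 - a\<^sup>2) * (z powi (- int j) * (z ^ d * cnj (H z)))
         - of_real a * cnj (z ^ (2 * s - n + j) * K z))"
      unfolding fourier_def
    proof (rule Bochner_Integration.integral_cong[OF refl])
      fix z assume "z \<in> space circle_haar"
      then have z: "cmod z = 1" by (simp add: space_circle_haar)
      then have z0: "z \<noteq> 0" by auto
      have pj: "z powi (- int j) = cnj (z ^ j)"
        using z by (simp add: power_int_minus inverse_eq_cnj norm_power del: complex_cnj_power)
      have pn: "z powi (int n - int j) = z powi (- int j) * z ^ n"
        using z0 by (simp add: power_int_diff power_int_minus divide_inverse)
      show "z powi (- int j) * (z ^ n * cnj (H' z)) = of_real a * z powi (int n - int j) + of_real (1 - a\<^sup>2) * (z powi (- int j) * (z ^ d * cnj (H z)))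
         - of_real a * cnj (z ^ (2 * s - n + j) * K z)"
        unfolding shift[OF z] pn pj by (simp add: algebra_simps power_add)
    qed
    also have "\<dots> = of_real a * (LINT z|circle_haar. z powi (int n - int j))
        + of_real (1 - a\<^sup>2) * fourier (\<lambda>z. z ^ d * cnj (H z)) (int j)
        - of_real a * (LINT z|circle_haar. cnj (z ^ (2 * s - n + j) * K z))"
    proof -
      have cont: "continuous_on (sphere 0 1) H" "continuous_on (sphere 0 1) K"
        using H(1) Kh by (auto intro!: continuous_on_subset[OF holomorphic_on_imp_continuous_on])
      have i: "integrable circle_haar (\<lambda>z. of_real a * z powi (int n - int j))"
        "integrable circle_haar (\<lambda>z. of_real (1 - a\<^sup>2) * (z powi (- int j) * (z ^ d * cnj (H z))))"
        "integrable circle_haar (\<lambda>z. of_real a * cnj (z ^ (2 * s - n + j) * K z))"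
        by (intro circle_haar_integrable_continuous continuous_intros cont; force)+
      show ?thesis unfolding fourier_def
        by (simp add: i integral_add integral_diff del: complex_cnj_mult complex_cnj_power of_real_diff of_real_power)
    qed
    also have "(LINT z|circle_haar. cnj (z ^ (2 * s - n + j) * K z)) = 0"
      using n by (intro cnj_holomorphic_fourier_zero Kh) (simp add: s_def)
    finally show ?thesis by (simp add: circle_haar_integral_powi)
  qed
  show thesis
    by (rule that[OF H'h _ F]) (use mo(2) in \<open>simp add: H'_def\<close>)
qed

text \<open>
  Each step multiplies the earlier coefficients by \<open>1 - a\<^sup>2\<close> and inserts the coefficient \<open>a\<close> at the
  frequency \<open>3\<^sup>N\<close>. Ratio 3 satisfies the gap condition of \<open>moebius_step\<close>, as \<open>2 \<cdot> 3\<^sup>N < 3\<^bsup>N+1\<^esup>\<close>.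
\<close>

lemma iterated_moebius:
  fixes a :: real
  assumes a: "0 \<le> a" "a < 1"
  shows "\<exists>H d. H holomorphic_on cball 0 1 \<and> (\<forall>z. cmod z \<le> 1 \<longrightarrow> cmod (H z) \<le> 1) \<and> 2 * d < 3 ^ N \<and>
    (\<forall>j. fourier (\<lambda>z. z ^ d * cnj (H z)) (int j) =
      of_real (\<Sum>k<N. if j = 3 ^ k then a * (1 - a\<^sup>2) ^ (N - Suc k) else 0))"
proof (induction N)
  case 0
  show ?case by (rule exI[of _ "\<lambda>_. 0"], rule exI[of _ 0]) (auto simp: fourier_def)
next
  case (Suc N)
  then obtain H d where H: "H holomorphic_on cball 0 1" "\<And>z. cmod z \<le> 1 \<Longrightarrow> cmod (H z) \<le> 1"
    and d: "2 * d < 3 ^ N" and F: "\<And>j. fourier (\<lambda>z. z ^ d * cnj (H z)) (int j) =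
      of_real (\<Sum>k<N. if j = 3 ^ k then a * (1 - a\<^sup>2) ^ (N - Suc k) else 0)" by blast
  obtain H' where H': "H' holomorphic_on cball 0 1" "\<And>z. cmod z \<le> 1 \<Longrightarrow> cmod (H' z) \<le> 1"
    and F': "\<And>j. fourier (\<lambda>z. z ^ (3 ^ N) * cnj (H' z)) (int j) =
       (if j = 3 ^ N then of_real a else 0) + of_real (1 - a\<^sup>2) * fourier (\<lambda>z. z ^ d * cnj (H z)) (int j)"
    using moebius_step[OF H a d] by blast
  have sum: "(\<Sum>k<Suc N. if j = 3 ^ k then a * (1 - a\<^sup>2) ^ (Suc N - Suc k) else 0) =
      (if j = 3 ^ N then a else 0) + (1 - a\<^sup>2) * (\<Sum>k<N. if j = 3 ^ k then a * (1 - a\<^sup>2) ^ (N - Suc k) else 0)"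
    for j :: nat
  proof -
    have "(\<Sum>k<N. if j = 3 ^ k then a * (1 - a\<^sup>2) ^ (Suc N - Suc k) else 0) =
        (1 - a\<^sup>2) * (\<Sum>k<N. if j = 3 ^ k then a * (1 - a\<^sup>2) ^ (N - Suc k) else 0)"
      unfolding sum_distrib_left by (intro sum.cong) (auto simp: Suc_diff_Suc[symmetric])
    then show ?thesis by (simp del: diff_Suc_Suc)
  qed
  show ?case
  proof (intro exI conjI allI impI)
    show "fourier (\<lambda>z. z ^ (3 ^ N) * cnj (H' z)) (int j) =
      of_real (\<Sum>k<Suc N. if j = 3 ^ k then a * (1 - a\<^sup>2) ^ (Suc N - Suc k) else 0)" for j
      unfolding F' F sum by simp
  qed (use H' in auto)
qed

text \<open>
  With \<open>a\<close> of order \<open>1 / \<surd>N\<close> the \<open>N\<close> damping factors \<open>1 - a\<^sup>2\<close> have a product bounded below, so all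
  \<open>N\<close> lacunary coefficients stay of order \<open>1 / \<surd>N\<close>. The analytic polynomial with these
  coefficients has value of order \<open>\<surd>N\<close> at 1; the negative frequencies of \<open>\<psi>\<close> bring the bound down to 1.
\<close>

lemma bounded_lacunary_symbol:
  assumes N: "N > 0"
  obtains \<psi> c where "\<psi> \<in> borel_measurable circle_haar" "\<And>z. z \<in> sphere 0 1 \<Longrightarrow> cmod (\<psi> z) \<le> 1"
    "\<And>j. fourier \<psi> (int j) = of_real (c j)" "\<And>j. c j \<ge> (0 :: real)"
    "\<And>k. k < N \<Longrightarrow> c (3 ^ k) \<ge> 1 / (4 * sqrt N)"
proof -
  \<comment> \<open>Then \<open>N a\<^sup>2 = 1/4\<close>, so by Bernoulli the damping is at least \<open>3/4\<close>; \<open>1/2\<close> is enough.\<close>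
  define a where "a = 1 / (2 * sqrt N)"
  have a2: "a\<^sup>2 = 1 / (4 * N)" by (simp add: a_def power_divide power_mult_distrib)
  have a: "0 \<le> a" "a < 1"
  proof -
    have "1 \<le> sqrt N" using N by simp
    then have "1 < 2 * sqrt N" by linarith
    then show "a < 1" using N by (simp add: a_def)
  qed (simp add: a_def)
  have a21: "a\<^sup>2 \<le> 1" using a by (simp add: power_le_one)
  obtain H d where H: "H holomorphic_on cball 0 1" "\<And>z. cmod z \<le> 1 \<Longrightarrow> cmod (H z) \<le> 1"
    and F: "\<And>j. fourier (\<lambda>z. z ^ d * cnj (H z)) (int j) =
      of_real (\<Sum>k<N. if j = 3 ^ k then a * (1 - a\<^sup>2) ^ (N - Suc k) else 0)"
    using iterated_moebius[OF a, of N] by blast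
  define c where "c j = (\<Sum>k<N. if j = 3 ^ k then a * (1 - a\<^sup>2) ^ (N - Suc k) else 0)" for j :: nat
  show thesis
  proof (rule that[of "\<lambda>z. z ^ d * cnj (H z)" c])
    have "continuous_on (sphere 0 1) H"
      using H(1) by (auto intro!: continuous_on_subset[OF holomorphic_on_imp_continuous_on])
    then show "(\<lambda>z. z ^ d * cnj (H z)) \<in> borel_measurable circle_haar"
      by (intro circle_haar_measurable_continuous continuous_intros)
    show "cmod (z ^ d * cnj (H z)) \<le> 1" if "z \<in> sphere 0 1" for z
      using that H(2)[of z] by (simp add: norm_mult norm_power)
    show "fourier (\<lambda>z. z ^ d * cnj (H z)) (int j) = of_real (c j)" for j
      unfolding F c_def ..
    show "c j \<ge> 0" for j unfolding c_def using a a21 by (intro sum_nonneg) auto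
    show "c (3 ^ k) \<ge> 1 / (4 * sqrt N)" if k: "k < N" for k
    proof -
      have "c (3 ^ k) = (\<Sum>i<N. if k = i then a * (1 - a\<^sup>2) ^ (N - Suc i) else 0)"
        unfolding c_def by (intro sum.cong) auto
      then have "c (3 ^ k) = a * (1 - a\<^sup>2) ^ (N - Suc k)" using k by simp
      moreover have "(1 - a\<^sup>2) ^ (N - Suc k) \<ge> 1 / 2"
      proof -
        have "1 + real (N - Suc k) * (- a\<^sup>2) \<le> (1 + (- a\<^sup>2)) ^ (N - Suc k)"
          using a21 by (intro Bernoulli_inequality) auto
        moreover have "real (N - Suc k) * a\<^sup>2 \<le> real N * a\<^sup>2" by (intro mult_right_mono) auto
        moreover have "real N * a\<^sup>2 = 1 / 4" using N by (simp add: a2)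
        ultimately show ?thesis by simp
      qed
      ultimately have "c (3 ^ k) \<ge> a * (1 / 2)" using a by (metis mult_left_mono)
      then show ?thesis by (simp add: a_def)
    qed
  qed
qed

section \<open>Diagonal operators\<close>

text \<open>
  Every operator below is diagonal in the standard basis. The entries are not required to vanish
  eventually, because a polynomial of a finite rank diagonal operator contains a multiple of the
  identity. The description determines an operator only if the sequence \<open>d\<close> is bounded, whence the
  bound \<open>e\<close> in the lemmas.
\<close>

definition diag_op :: "(nat \<Rightarrow> real) \<Rightarrow> (ell2 \<Rightarrow>\<^sub>L ell2)"
  where "diag_op d = (THE A :: ell2 \<Rightarrow>\<^sub>L ell2. \<forall>h n. coord (A h) n = of_real (d n) * coord h n)"

lemma diag_norm_bound:
  assumes "\<And>h n. coord (A h) n = of_real (d n) * coord h n" "\<And>n. \<bar>d n\<bar> \<le> e"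
  shows "norm (A h) \<le> e * norm h"
proof -
  have e: "0 \<le> e" using assms(2)[of 0] by linarith
  have "(\<Sum>n<N. (cmod (coord (A h) n))\<^sup>2) \<le> (e * norm h)\<^sup>2" for N
  proof -
    have "(\<Sum>n<N. (cmod (coord (A h) n))\<^sup>2) \<le> (\<Sum>n<N. e\<^sup>2 * (cmod (coord h n))\<^sup>2)"
      using assms(2) e
      by (intro sum_mono)
        (auto simp: assms(1) norm_mult power_mult_distrib intro!: mult_right_mono power2_le_iff_abs_le[THEN iffD2])
    also have "\<dots> \<le> e\<^sup>2 * (norm h)\<^sup>2"
      unfolding sum_distrib_left[symmetric]
      using norm_ell2_le_iff[of "norm h" h] by (intro mult_left_mono) auto
    finally show ?thesis by (simp add: power_mult_distrib)
  qed
  then show ?thesis using e by (subst norm_ell2_le_iff) auto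
qed

lemma coord_diag_op:
  assumes "\<And>n. \<bar>d n\<bar> \<le> e"
  shows "coord (diag_op d h) n = of_real (d n) * coord h n"
proof -
  have e: "0 \<le> e" using assms(1)[of 0] by linarith
  have sq: "(d n)\<^sup>2 \<le> e\<^sup>2" for n using assms[of n] e by (simp add: abs_le_square_iff[symmetric])
  have sm: "summable (\<lambda>n. (cmod (of_real (d n) * coord h n))\<^sup>2)" for h
  proof (rule summable_comparison_test')
    show "summable (\<lambda>n. e\<^sup>2 * (cmod (coord h n))\<^sup>2)" by (intro summable_mult summable_coord)
    show "norm ((cmod (of_real (d n) * coord h n))\<^sup>2) \<le> e\<^sup>2 * (cmod (coord h n))\<^sup>2" for n
      using sq[of n] by (simp add: norm_mult power_mult_distrib mult_right_mono)
  qed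
  define D where "D h = Abs_ell2 (\<lambda>n. of_real (d n) * coord h n)" for h
  have D: "coord (D h) n = of_real (d n) * coord h n" for h n
    unfolding D_def by (subst Abs_ell2_inverse) (use sm in auto)
  have "bounded_linear D"
  proof (rule bounded_linear_intro)
    show "D (x + y) = D x + D y" for x y
      by (rule ell2_eqI) (simp add: D coord_simps distrib_left)
    show "D (r *\<^sub>R x) = r *\<^sub>R D x" for r x
      by (rule ell2_eqI) (simp add: D coord_simps)
    show "norm (D h) \<le> norm h * e" for h
      using diag_norm_bound[of D d e h] D assms by (simp add: mult.commute)
  qed
  then have ex: "\<forall>h n. coord (Blinfun D h) n = of_real (d n) * coord h n"
    by (simp add: bounded_linear_Blinfun_apply D)
  have "\<forall>h n. coord (diag_op d h) n = of_real (d n) * coord h n"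
    unfolding diag_op_def
    by (rule theI[where a = "Blinfun D"]) (auto intro!: blinfun_eqI ell2_eqI simp: ex)
  then show ?thesis by blast
qed

lemma diag_op_eqI:
  fixes A :: "ell2 \<Rightarrow>\<^sub>L ell2"
  assumes "\<And>n. \<bar>d n\<bar> \<le> e" "\<And>h n. coord (A h) n = of_real (d n) * coord h n"
  shows "A = diag_op d"
  by (intro blinfun_eqI ell2_eqI) (simp add: assms coord_diag_op[OF assms(1)])

lemma norm_diag_op_le:
  assumes "\<And>n. \<bar>d n\<bar> \<le> e"
  shows "norm (diag_op d) \<le> e"
proof (rule norm_blinfun_bound)
  show "0 \<le> e" using assms[of 0] by linarith
  show "norm (diag_op d h) \<le> e * norm h" for h
    by (rule diag_norm_bound[OF coord_diag_op[OF assms] assms])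
qed

lemma coord_unit_vec: "coord (unit_vec k) n = (if n = k then 1 else 0)"
  by transfer simp

lemma norm_unit_vec: "norm (unit_vec k) = 1"
proof -
  have "(\<lambda>n. (cmod (coord (unit_vec k) n))\<^sup>2) = (\<lambda>n. if n = k then 1 else 0)"
    by (auto simp: coord_unit_vec)
  then show ?thesis using suminf_finite[of "{k}" "\<lambda>n. if n = k then 1 else 0 :: real"]
    by (simp add: norm_ell2_def)
qed

lemma cinner_unit_vec: "cinner x (unit_vec k) = coord x k"
  unfolding cinner_def
  by (subst suminf_finite[of "{k}"]) (auto simp: coord_unit_vec)

lemma diag_op_entry_le_norm:
  assumes "\<And>n. \<bar>d n\<bar> \<le> e"
  shows "\<bar>d n\<bar> \<le> norm (diag_op d)"
  using cmod_coord_le[of "diag_op d (unit_vec n)" n] norm_blinfun[of "diag_op d" "unit_vec n"]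
  by (simp add: coord_diag_op[OF assms] coord_unit_vec norm_unit_vec)

lemma coord_sum: "coord (\<Sum>i\<in>I. F i) n = (\<Sum>i\<in>I. coord (F i) n)"
  by (induction I rule: infinite_finite_induct) (simp_all add: coord_simps)

lemma op_poly_diag_op:
  assumes "\<And>n. \<bar>d n\<bar> \<le> e"
  shows "coord (op_poly r (diag_op d) h) n = of_real (poly r (d n)) * coord h n"
proof -
  have "coord ((((\<lambda>X. diag_op d o\<^sub>L X) ^^ i) id_blinfun) h) n = of_real (d n ^ i) * coord h n" for i
    by (induction i) (simp_all add: coord_diag_op[OF assms] mult.assoc)
  then show ?thesis
    by (simp add: op_poly_def blinfun.sum_left blinfun.scaleR_left coord_sum coord_simps
        poly_altdef sum_distrib_right mult.assoc[symmetric] scaleR_conv_of_real)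
qed

lemma powr_poly_approx:
  assumes "s > 0" "\<epsilon> > 0"
  shows "\<exists>r. \<forall>t\<in>{0..M}. \<bar>poly r t - t powr s\<bar> \<le> (\<epsilon>::real)"
proof -
  have "continuous_on {0..M} (\<lambda>t. t powr s)"
    using assms by (intro continuous_on_powr') auto
  then obtain g where g: "real_polynomial_function g" "\<And>t. t \<in> {0..M} \<Longrightarrow> \<bar>t powr s - g t\<bar> < \<epsilon>"
    using Stone_Weierstrass_real_polynomial_function[of "{0..M}" "\<lambda>t. t powr s" \<epsilon>] assms by auto
  then obtain a n where an: "g = (\<lambda>x. \<Sum>i\<le>n. a i * x ^ i)"
    using real_polynomial_function_iff_sum by blast
  have "poly (\<Sum>i\<le>n. monom (a i) i) t = g t" for t
    by (simp add: an poly_sum poly_monom)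
  then show ?thesis using g(2) by (intro exI[of _ "\<Sum>i\<le>n. monom (a i) i"]) (auto simp: abs_minus_commute less_imp_le)
qed

text \<open>
  Polynomials act entrywise on a diagonal operator, and the entries lie in the interval
  \<open>[0, \<parallel>A\<parallel>]\<close> on which the polynomials approximate \<open>t\<^sup>s\<close>; so \<open>r(A)\<close> is as close to the diagonal
  operator of powers as \<open>r\<close> is to \<open>t\<^sup>s\<close>. This gives both existence (with Weierstrass' theorem)
  and uniqueness of the limit.
\<close>

lemma op_powr_diag_op:
  assumes d: "\<And>n. 0 \<le> d n" "\<And>n. d n \<le> e" and s: "s > 0"
  shows "op_powr (diag_op d) s = diag_op (\<lambda>n. d n powr s)"
proof -
  let ?A = "diag_op d" and ?B = "diag_op (\<lambda>n. d n powr s)"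
  have de: "\<bar>d n\<bar> \<le> e" for n using d by simp
  have pe: "\<bar>d n powr s\<bar> \<le> e powr s" for n using d s by (simp add: powr_mono2)
  have rng: "d n \<in> {0..norm ?A}" for n
    using diag_op_entry_le_norm[OF de] d by simp
  have close: "norm (op_poly r ?A - ?B) \<le> \<epsilon>"
    if r: "\<forall>t\<in>{0..norm ?A}. \<bar>poly r t - t powr s\<bar> \<le> \<epsilon>" for r \<epsilon>
  proof -
    have b: "\<bar>poly r (d n) - d n powr s\<bar> \<le> \<epsilon>" for n using r rng by blast
    have "op_poly r ?A - ?B = diag_op (\<lambda>n. poly r (d n) - d n powr s)"
      by (rule diag_op_eqI[OF b])
        (simp add: blinfun.diff_left coord_simps op_poly_diag_op[OF de] coord_diag_op[OF pe] algebra_simps)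
    then show ?thesis using norm_diag_op_le[OF b] by simp
  qed
  show ?thesis unfolding op_powr_def
  proof (rule the_equality)
    show "\<forall>\<epsilon>>0. \<exists>r. (\<forall>t\<in>{0..norm ?A}. \<bar>poly r t - t powr s\<bar> \<le> \<epsilon>) \<and> norm (op_poly r ?A - ?B) \<le> \<epsilon>"
      using powr_poly_approx[OF s] close by meson
  next
    fix B assume B: "\<forall>\<epsilon>>0. \<exists>r. (\<forall>t\<in>{0..norm ?A}. \<bar>poly r t - t powr s\<bar> \<le> \<epsilon>) \<and> norm (op_poly r ?A - B) \<le> \<epsilon>"
    have "norm (B - ?B) \<le> \<epsilon>" if "\<epsilon> > 0" for \<epsilon>
    proof -
      have "\<epsilon>/2 > 0" using that by simp
      then obtain r where r: "\<forall>t\<in>{0..norm ?A}. \<bar>poly r t - t powr s\<bar> \<le> \<epsilon>/2" "norm (op_poly r ?A - B) \<le> \<epsilon>/2"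
        using B by blast
      have "norm ((op_poly r ?A - ?B) - (op_poly r ?A - B)) \<le> \<epsilon>/2 + \<epsilon>/2"
        by (rule order_trans[OF norm_triangle_ineq4 add_mono[OF close[OF r(1)] r(2)]])
      then show ?thesis by simp
    qed
    then have "norm (B - ?B) \<le> 0" by (rule field_le_epsilon) simp
    then show "B = ?B" by simp
  qed
qed

lemma adj_diag_op:
  assumes "\<And>n. \<bar>d n\<bar> \<le> e"
  shows "adj (diag_op d) = diag_op d"
  unfolding adj_def
proof (rule the_equality)
  show *: "\<forall>x y. cinner (diag_op d x) y = cinner x (diag_op d y)"
    by (simp add: cinner_def coord_diag_op[OF assms] mult_ac)
  fix S assume S: "\<forall>x y. cinner (diag_op d x) y = cinner x (blinfun_apply S y)"
  show "S = diag_op d"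
  proof (intro blinfun_eqI ell2_eqI)
    fix y n
    have "cinner (unit_vec n) (S y) = cinner (unit_vec n) (diag_op d y)" using S * by metis
    then show "coord (S y) n = coord (diag_op d y) n"
      by (metis cinner_commute cinner_unit_vec complex_cnj_cnj)
  qed
qed

lemma op_abs_diag_op:
  assumes "\<And>n. 0 \<le> d n" "\<And>n. d n \<le> e"
  shows "op_abs (diag_op d) = diag_op d"
proof -
  have de: "\<bar>d n\<bar> \<le> e" for n using assms by simp
  have sq: "\<bar>(d n)\<^sup>2\<bar> \<le> e\<^sup>2" for n using assms by (simp add: power_mono)
  have "diag_op d o\<^sub>L diag_op d = diag_op (\<lambda>n. (d n)\<^sup>2)"
    by (rule diag_op_eqI[OF sq]) (simp add: coord_diag_op[OF de] power2_eq_square mult.assoc)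
  moreover have "op_powr (diag_op (\<lambda>n. (d n)\<^sup>2)) (1/2) = diag_op (\<lambda>n. ((d n)\<^sup>2) powr (1/2))"
    using sq by (intro op_powr_diag_op) auto
  ultimately show ?thesis using assms(1) by (simp add: op_abs_def adj_diag_op[OF de] powr_half_sqrt)
qed

lemma schatten_norm_diag_op:
  assumes d: "\<And>n. 0 \<le> d n" "\<And>n. n \<ge> N \<Longrightarrow> d n = 0" and p: "p > 0"
  shows "schatten_norm p (diag_op d) = ennreal ((\<Sum>n<N. d n powr p) powr (1/p))"
proof -
  define e where "e = Max (insert 0 (d ` {..<N}))"
  have de: "d n \<le> e" for n
    unfolding e_def by (cases "n < N") (auto simp: d(2) intro: Max_ge)
  have pe: "\<bar>d n powr p\<bar> \<le> e powr p" for n using d(1) de p by (simp add: powr_mono2)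
  have "op_trace (op_powr (op_abs (diag_op d)) p) = (\<Sum>n. ennreal (d n powr p))"
    by (simp add: op_abs_diag_op[OF d(1) de] op_powr_diag_op[OF d(1) de p] op_trace_def
        cinner_unit_vec coord_diag_op[OF pe] coord_unit_vec)
  also have "\<dots> = (\<Sum>n<N. ennreal (d n powr p))"
    using d(2) by (intro suminf_finite) auto
  also have "\<dots> = ennreal (\<Sum>n<N. d n powr p)" by (rule sum_ennreal) simp
  finally show ?thesis by (simp add: schatten_norm_def sum_nonneg)
qed

section \<open>Lacunary polynomials with orthogonal coefficients\<close>

definition fin_vec :: "nat \<Rightarrow> (nat \<Rightarrow> complex) \<Rightarrow> ell2"
  where "fin_vec N F = (\<Sum>k<N. scaleC (F k) (unit_vec k))"

lemma coord_fin_vec: "coord (fin_vec N F) n = (if n < N then F n else 0)"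
proof -
  have "coord (fin_vec N F) n = (\<Sum>k<N. if n = k then F k else 0)"
    unfolding fin_vec_def coord_sum by (intro sum.cong) (auto simp: coord_simps coord_unit_vec)
  then show ?thesis by simp
qed

lemma norm_fin_vec: "norm (fin_vec N F) = sqrt (\<Sum>k<N. (cmod (F k))\<^sup>2)"
proof -
  have "(\<Sum>n. (cmod (coord (fin_vec N F) n))\<^sup>2) = (\<Sum>n<N. (cmod (coord (fin_vec N F) n))\<^sup>2)"
    by (intro suminf_finite) (auto simp: coord_fin_vec)
  then show ?thesis by (simp add: norm_ell2_def coord_fin_vec)
qed

lemma scaleC_fin_vec: "scaleC c (fin_vec N F) = fin_vec N (\<lambda>k. c * F k)"
  by (rule ell2_eqI) (simp add: coord_simps coord_fin_vec)

lemma cinner_fin_vec: "cinner h (fin_vec N F) = (\<Sum>k<N. coord h k * cnj (F k))"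
proof -
  have "cinner h (fin_vec N F) = (\<Sum>k<N. coord h k * cnj (coord (fin_vec N F) k))"
    unfolding cinner_def by (intro suminf_finite) (auto simp: coord_fin_vec)
  then show ?thesis by (simp add: coord_fin_vec)
qed

lemma bounded_linear_coord: "bounded_linear (\<lambda>x. coord x n)"
  by (rule bounded_linear_intro[where K = 1]) (simp_all add: coord_simps cmod_coord_le)

lemma bounded_linear_scaleC_left: "bounded_linear (\<lambda>c. scaleC c v)"
  by (rule bounded_linear_intro[where K = "norm v"])
    (auto intro!: ell2_eqI simp: coord_simps norm_scaleC distrib_right)

lemma continuous_on_fin_vec:
  assumes "\<And>k. k < N \<Longrightarrow> continuous_on S (\<lambda>z. F z k)"
  shows "continuous_on S (\<lambda>z. fin_vec N (F z))"
  unfolding fin_vec_def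
  by (intro continuous_on_sum bounded_linear.continuous_on[OF bounded_linear_scaleC_left] assms) auto

lemma coord_integral_fin_vec:
  assumes "\<And>k. k < N \<Longrightarrow> continuous_on (sphere 0 1) (\<lambda>z. F z k)"
  shows "coord (LINT z|circle_haar. fin_vec N (F z)) n =
    (if n < N then LINT z|circle_haar. F z n else 0)"
proof -
  have "coord (LINT z|circle_haar. fin_vec N (F z)) n = (LINT z|circle_haar. coord (fin_vec N (F z)) n)"
    by (rule integral_bounded_linear[OF bounded_linear_coord, symmetric])
      (intro circle_haar_integrable_continuous continuous_on_fin_vec assms)
  then show ?thesis by (simp add: coord_fin_vec)
qed

definition lacunary_poly :: "nat \<Rightarrow> (nat \<Rightarrow> real) \<Rightarrow> complex \<Rightarrow> ell2"
  where "lacunary_poly N s z = fin_vec N (\<lambda>k. of_real (s k) * z ^ 3 ^ k)"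

lemma norm_lacunary_poly: "cmod z = 1 \<Longrightarrow> norm (lacunary_poly N s z) = sqrt (\<Sum>k<N. (s k)\<^sup>2)"
  by (simp add: lacunary_poly_def norm_fin_vec norm_mult norm_power power_mult_distrib)

lemma powi_three_power: "z powi (3 ^ k) = z ^ 3 ^ k"
  using power_int_of_nat[of z "3 ^ k"] by simp

lemma coord_vfourier_lacunary_poly:
  "coord (vfourier (lacunary_poly N s) m) k = (if k < N \<and> m = 3 ^ k then of_real (s k) else 0)"
proof -
  have "coord (vfourier (lacunary_poly N s) m) k =
      (if k < N then LINT z|circle_haar. z powi (- m) * (of_real (s k) * z ^ 3 ^ k) else 0)"
    unfolding vfourier_def lacunary_poly_def scaleC_fin_vec
    by (rule coord_integral_fin_vec) (intro continuous_intros; force)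
  also have "(LINT z|circle_haar. z powi (- m) * (of_real (s k) * z ^ 3 ^ k)) =
      (LINT z|circle_haar. of_real (s k) * z powi (3 ^ k - m))"
  proof (rule Bochner_Integration.integral_cong[OF refl])
    fix z assume "z \<in> space circle_haar"
    then have "z \<noteq> 0" by (auto simp: space_circle_haar)
    then have "z powi (int (3 ^ k) - m) = z ^ 3 ^ k * z powi (- m)"
      unfolding diff_conv_add_uminus by (subst power_int_add) (simp_all add: powi_three_power)
    then show "z powi (- m) * (of_real (s k) * z ^ 3 ^ k) = of_real (s k) * z powi (3 ^ k - m)"
      by simp
  qed
  also have "\<dots> = of_real (s k) * (if m = 3 ^ k then 1 else 0)"
    by (simp add: circle_haar_integral_powi)
  finally show ?thesis by simp
qed

lemma Hardy_lacunary_poly: "lacunary_poly N s \<in> Hardy q"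
proof -
  interpret prob_space circle_haar by (rule prob_space_circle_haar)
  have "continuous_on (sphere 0 1) (lacunary_poly N s)"
    unfolding lacunary_poly_def by (intro continuous_on_fin_vec continuous_intros)
  then have "lacunary_poly N s \<in> borel_measurable circle_haar"
    by (rule circle_haar_measurable_continuous)
  moreover have "integrable circle_haar (\<lambda>z. norm (lacunary_poly N s z) powr q) \<longleftrightarrow>
      integrable circle_haar (\<lambda>z. sqrt (\<Sum>k<N. (s k)\<^sup>2) powr q)"
    by (rule Bochner_Integration.integrable_cong) (auto simp: norm_lacunary_poly space_circle_haar)
  moreover have "vfourier (lacunary_poly N s) n = 0" if "n < 0" for n
  proof (rule ell2_eqI)
    have "n \<noteq> 3 ^ k" for k using that by (metis not_less zero_le_numeral zero_le_power)
    then show "coord (vfourier (lacunary_poly N s) n) k = coord 0 k" for k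
      by (simp add: coord_vfourier_lacunary_poly coord_simps)
  qed
  ultimately show ?thesis by (simp add: Hardy_def Lq_def)
qed

lemma Lq_norm_lacunary_poly:
  assumes "q \<ge> 1"
  shows "Lq_norm q (lacunary_poly N s) = sqrt (\<Sum>k<N. (s k)\<^sup>2)"
proof -
  interpret prob_space circle_haar by (rule prob_space_circle_haar)
  have "(LINT z|circle_haar. norm (lacunary_poly N s z) powr q) =
      (LINT z|circle_haar. sqrt (\<Sum>k<N. (s k)\<^sup>2) powr q)"
    by (rule Bochner_Integration.integral_cong) (auto simp: norm_lacunary_poly space_circle_haar)
  then show ?thesis using assms by (simp add: Lq_norm_def prob_space powr_powr sum_nonneg)
qed

lemma is_conv_lacunary_poly:
  assumes "\<And>k. k < N \<Longrightarrow> fps_nth \<phi> (3 ^ k) * of_real (s k) = of_real (t k)"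
  shows "is_conv (lacunary_poly N s) \<phi> (lacunary_poly N t)"
  unfolding is_conv_def
proof (intro conjI allI Hardy_lacunary_poly ell2_eqI)
  fix n k
  have "int n = 3 ^ k \<longleftrightarrow> n = 3 ^ k" by (metis of_nat_eq_iff of_nat_numeral of_nat_power)
  then show "coord (vfourier (lacunary_poly N t) (int n)) k =
      coord (scaleC (fps_nth \<phi> n) (vfourier (lacunary_poly N s) (int n))) k"
    using assms[of k] by (simp add: coord_simps coord_vfourier_lacunary_poly)
qed

text \<open>
  The \<open>k\<close>-th coordinate is a multiple of \<open>z\<close> to the power \<open>3\<^sup>k\<close>. Different coordinates have
  different frequencies, so orthogonality of the characters removes all off-diagonal entries.
\<close>

lemma op_integral_lacunary_poly:
  "op_integral circle_haar (\<lambda>z. rank_one (lacunary_poly N s z)) =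
    diag_op (\<lambda>k. if k < N then (s k)\<^sup>2 else 0)"
proof -
  define d where "d k = (if k < N then (s k)\<^sup>2 else 0)" for k
  have de: "\<bar>d k\<bar> \<le> (\<Sum>k<N. (s k)\<^sup>2)" for k
    unfolding d_def by (auto intro!: member_le_sum sum_nonneg)
  have "(LINT z|circle_haar. rank_one (lacunary_poly N s z) h) = diag_op d h" for h
  proof (rule ell2_eqI)
    fix n
    have "coord (LINT z|circle_haar. rank_one (lacunary_poly N s z) h) n =
       (if n < N then LINT z|circle_haar.
          (\<Sum>k<N. coord h k * cnj (of_real (s k) * z ^ 3 ^ k)) * (of_real (s n) * z ^ 3 ^ n) else 0)"
      unfolding rank_one_apply lacunary_poly_def cinner_fin_vec scaleC_fin_vec
      by (rule coord_integral_fin_vec) (intro continuous_intros)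
    also have "(LINT z|circle_haar.
          (\<Sum>k<N. coord h k * cnj (of_real (s k) * z ^ 3 ^ k)) * (of_real (s n) * z ^ 3 ^ n)) =
        (LINT z|circle_haar. (\<Sum>k<N. coord h k * of_real (s k) * of_real (s n) * z powi (3 ^ n - 3 ^ k)))"
    proof (rule Bochner_Integration.integral_cong[OF refl])
      fix z assume "z \<in> space circle_haar"
      then have z: "cmod z = 1" by (simp add: space_circle_haar)
      have p: "z powi (int (3 ^ n) - int (3 ^ k)) = cnj (z ^ 3 ^ k) * z ^ 3 ^ n" for k
      proof -
        have "z powi (int (3 ^ n) + (- int (3 ^ k))) = z ^ 3 ^ n * z powi (- int (3 ^ k))"
          using z by (subst power_int_add) (auto simp: powi_three_power)
        also have "z powi (- int (3 ^ k)) = cnj (z ^ 3 ^ k)"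
          using z by (simp add: power_int_minus inverse_eq_cnj norm_power del: complex_cnj_power of_nat_power)
        finally show ?thesis by (simp add: mult.commute)
      qed
      show "(\<Sum>k<N. coord h k * cnj (of_real (s k) * z ^ 3 ^ k)) * (of_real (s n) * z ^ 3 ^ n) =
          (\<Sum>k<N. coord h k * of_real (s k) * of_real (s n) * z powi (3 ^ n - 3 ^ k))"
        unfolding sum_distrib_right using p by (intro sum.cong) (simp_all add: mult_ac)
    qed
    also have "\<dots> = (\<Sum>k<N. LINT z|circle_haar. coord h k * of_real (s k) * of_real (s n) * z powi (3 ^ n - 3 ^ k))"
      by (intro Bochner_Integration.integral_sum circle_haar_integrable_continuous continuous_intros) auto
    also have "\<dots> = (\<Sum>k<N. if n = k then coord h k * of_real (s k) * of_real (s n) else 0)"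
      by (intro sum.cong) (auto simp: circle_haar_integral_powi)
    finally show "coord (LINT z|circle_haar. rank_one (lacunary_poly N s z) h) n = coord (diag_op d h) n"
      by (simp add: coord_diag_op[OF de]) (simp add: d_def power2_eq_square mult_ac)
  qed
  then have "op_integral circle_haar (\<lambda>z. rank_one (lacunary_poly N s z)) = diag_op d"
    by (simp add: op_integral_def blinfun_apply_inverse)
  then show ?thesis by (simp add: d_def[abs_def])
qed

lemma schatten_norm_lacunary:
  assumes "p > 0" "\<And>k. 0 \<le> s k"
  shows "schatten_norm p (op_powr (op_integral circle_haar (\<lambda>z. rank_one (lacunary_poly N s z))) (1/2))
    = ennreal ((\<Sum>k<N. s k powr p) powr (1/p))"
proof -
  define d where "d k = (if k < N then (s k)\<^sup>2 else 0)" for k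
  have de: "d k \<le> (\<Sum>k<N. (s k)\<^sup>2)" for k
    unfolding d_def by (auto intro!: member_le_sum sum_nonneg)
  have "op_powr (diag_op d) (1/2) = diag_op (\<lambda>k. d k powr (1/2))"
    by (rule op_powr_diag_op[OF _ de]) (simp_all add: d_def)
  then have "schatten_norm p (op_powr (diag_op d) (1/2)) = ennreal ((\<Sum>k<N. (d k powr (1/2)) powr p) powr (1/p))"
    by (simp add: schatten_norm_diag_op[where N = N] assms d_def)
  also have "(\<Sum>k<N. (d k powr (1/2)) powr p) = (\<Sum>k<N. s k powr p)"
    by (intro sum.cong) (simp_all add: d_def powr_half_sqrt assms)
  finally show ?thesis unfolding op_integral_lacunary_poly d_def[abs_def] .
qed


section \<open>The growth rates compared\<close>

text \<open>
  A multiplier of norm at most 1 arises by taking square roots of the nonnegative coefficients of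
  the bounded symbol, which turns \<open>1 / (4 \<surd>N)\<close> into \<open>1 / (2 N\<^bsup>1/4\<^esup>)\<close>.
\<close>

lemma lacunary_multiplier:
  assumes N: "N > 0"
  obtains \<phi> t where "\<phi> \<in> BMOA2" "BMOA2_norm \<phi> \<le> 1" "\<And>k. 0 \<le> t k"
    "\<And>k. k < N \<Longrightarrow> fps_nth \<phi> (3 ^ k) = of_real (t k)"
    "\<And>k. k < N \<Longrightarrow> t k \<ge> 1 / (2 * real N powr (1/4))"
proof -
  obtain \<psi> c where \<psi>: "\<psi> \<in> borel_measurable circle_haar" "\<And>z. z \<in> sphere 0 1 \<Longrightarrow> cmod (\<psi> z) \<le> 1"
    and c: "\<And>j. fourier \<psi> (int j) = of_real (c j)" "\<And>j. c j \<ge> (0 :: real)"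
      "\<And>k. k < N \<Longrightarrow> c (3 ^ k) \<ge> 1 / (4 * sqrt N)"
    using bounded_lacunary_symbol[OF N] by blast
  define \<phi> where "\<phi> = Abs_fps (\<lambda>n. complex_of_real (sqrt (c n)))"
  have "BMOA2_series \<phi> = Abs_fps (\<lambda>n. of_real (c n))"
    by (simp add: BMOA2_series_def \<phi>_def c(2) flip: of_real_power)
  moreover have "\<psi> \<in> Linf"
    using \<psi> by (intro Linf_I[where C = 1] AE_I2) (auto simp: space_circle_haar)
  ultimately have mem: "\<psi> \<in> BMOA_class (BMOA2_series \<phi>)"
    using c(1) by (simp add: BMOA_class_def)
  have "Linf_norm \<psi> \<le> 1"
    unfolding Linf_norm_def using \<psi> by (intro esssup_I AE_I2) (auto simp: space_circle_haar)
  then have le: "BMOA_norm (BMOA2_series \<phi>) \<le> 1"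
    unfolding BMOA_norm_def using mem by (rule INF_lower2[rotated])
  show thesis
  proof (rule that[of \<phi> "\<lambda>k. sqrt (c (3 ^ k))"])
    show "\<phi> \<in> BMOA2" using le by (auto simp: BMOA2_def intro: le_less_trans)
    show "BMOA2_norm \<phi> \<le> 1"
      unfolding BMOA2_norm_def using enn2real_mono[OF le] by simp
    show "fps_nth \<phi> (3 ^ k) = of_real (sqrt (c (3 ^ k)))" for k by (simp add: \<phi>_def)
    show "sqrt (c (3 ^ k)) \<ge> 1 / (2 * real N powr (1/4))" if "k < N" for k
    proof (rule real_le_rsqrt)
      have "(real N powr (1/4))\<^sup>2 = sqrt N"
        by (simp add: power2_eq_square powr_half_sqrt flip: powr_add)
      then have "(1 / (2 * real N powr (1/4)))\<^sup>2 = 1 / (4 * sqrt N)"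
        by (simp add: power_divide power_mult_distrib)
      then show "(1 / (2 * real N powr (1/4)))\<^sup>2 \<le> c (3 ^ k)" using c(3)[OF that] by simp
    qed
  qed (simp add: c)
qed

lemma powr_bounded_imp_nonpos:
  assumes "\<And>N. N > 0 \<Longrightarrow> real N powr \<delta> \<le> C"
  shows "\<delta> \<le> 0"
proof (rule ccontr)
  assume "\<not> \<delta> \<le> 0"
  then have "filterlim (\<lambda>N. real N powr \<delta>) at_top sequentially" by real_asymp
  then have "eventually (\<lambda>N. real N powr \<delta> > C \<and> N > 0) sequentially"
    by (intro eventually_conj eventually_gt_at_top) (auto simp: filterlim_at_top_dense)
  then obtain N where "real N powr \<delta> > C" "N > 0"
    using eventually_happens'[OF sequentially_bot] by blast
  then show False using assms[of N] by linarith
qed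

theorem proposition6p10:
  fixes p :: real
  assumes "p > 0"
    and "\<exists>q::real. q \<ge> 1 \<and> (\<exists>c::real. c > 0 \<and>
           (\<forall>\<phi>\<in>BMOA2. \<forall>f\<in>Hardy q. \<forall>g. is_conv f \<phi> g \<longrightarrow>
              schatten_norm p (op_powr (op_integral circle_haar (\<lambda>z. rank_one (g z))) (1/2))
                \<le> ennreal (c * BMOA2_norm \<phi> * Lq_norm q f)))"
  shows "p \<ge> 4/3"
proof -
  obtain q c where q: "q \<ge> 1" and c: "c > 0" and ineq: "\<And>\<phi> f g. \<phi> \<in> BMOA2 \<Longrightarrow> f \<in> Hardy q \<Longrightarrow> is_conv f \<phi> g \<Longrightarrow>
      schatten_norm p (op_powr (op_integral circle_haar (\<lambda>z. rank_one (g z))) (1/2))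
        \<le> ennreal (c * BMOA2_norm \<phi> * Lq_norm q f)"
    using assms(2) by blast
  \<comment> \<open>Lower bound \<open>N\<^bsup>1/p\<^esup> b\<close> with \<open>b = 1 / (2 N\<^bsup>1/4\<^esup>)\<close> against upper bound \<open>c \<surd>N\<close>.\<close>
  have "real N powr (1/p - 3/4) \<le> 2 * c" if N: "N > 0" for N
  proof -
    obtain \<phi> t where \<phi>: "\<phi> \<in> BMOA2" "BMOA2_norm \<phi> \<le> 1" and t: "\<And>k. 0 \<le> t k"
      "\<And>k. k < N \<Longrightarrow> fps_nth \<phi> (3 ^ k) = of_real (t k)"
      "\<And>k. k < N \<Longrightarrow> t k \<ge> 1 / (2 * real N powr (1/4))"
      using lacunary_multiplier[OF N] by blast
    have "is_conv (lacunary_poly N (\<lambda>_. 1)) \<phi> (lacunary_poly N t)"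
      by (rule is_conv_lacunary_poly) (simp add: t(2))
    from ineq[OF \<phi>(1) Hardy_lacunary_poly this]
    have "ennreal ((\<Sum>k<N. t k powr p) powr (1/p)) \<le> ennreal (c * BMOA2_norm \<phi> * sqrt N)"
      by (simp add: schatten_norm_lacunary assms(1) t(1) Lq_norm_lacunary_poly q)
    then have "(\<Sum>k<N. t k powr p) powr (1/p) \<le> c * BMOA2_norm \<phi> * sqrt N"
      using c by (subst (asm) ennreal_le_iff) (auto simp: BMOA2_norm_def)
    also have "\<dots> \<le> c * 1 * sqrt N"
      using c \<phi>(2) by (intro mult_right_mono mult_left_mono) auto
    finally have upper: "(\<Sum>k<N. t k powr p) powr (1/p) \<le> c * real N powr (1/2)"
      by (simp add: powr_half_sqrt)
    define b where "b = 1 / (2 * real N powr (1/4))"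
    have b: "b > 0" using N by (simp add: b_def)
    have "b powr p \<le> t k powr p" if "k < N" for k
      using t(3)[OF that] b assms(1) by (intro powr_mono2) (auto simp: b_def)
    then have "real N * b powr p \<le> (\<Sum>k<N. t k powr p)"
      using sum_bounded_below[of "{..<N}" "b powr p" "\<lambda>k. t k powr p"] by auto
    then have "(real N * b powr p) powr (1/p) \<le> (\<Sum>k<N. t k powr p) powr (1/p)"
      using assms(1) by (intro powr_mono2) auto
    also have "(real N * b powr p) powr (1/p) = real N powr (1/p) * b"
      using assms(1) b by (simp add: powr_mult powr_powr)
    finally have "real N powr (1/p) * b \<le> c * real N powr (1/2)" using upper by linarith
    then have "real N powr (1/p) \<le> 2 * c * (real N powr (1/2) * real N powr (1/4))"
      using N by (simp add: b_def field_simps)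
    also have "real N powr (1/2) * real N powr (1/4) = real N powr (3/4)"
      by (simp flip: powr_add)
    finally show ?thesis using N by (simp add: powr_diff pos_divide_le_eq)
  qed
  then have "1/p - 3/4 \<le> 0" by (rule powr_bounded_imp_nonpos)
  then show ?thesis using assms(1) by (simp add: field_simps)
qed

end
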